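(* Let $T>0$ and let $g:\mathbb{R}^2\to\mathbb{R}$ be of class $C^3$ (with the properties listed in the context). The mapping $$G:H^1(0,T;\mathbb{R}^2)\to H^1(0,T),\qquad G(\gamma)=g\circ\gamma,$$ is twice continuously (Fréchet) differentiable, and its derivatives are given by $$DG(\gamma)\delta\gamma=g'(\gamma)\delta\gamma\quad\forall\,\delta\gamma\in H^1(0,T;\mathbb{R}^2),\qquad D^2G(\gamma)[\delta\gamma,\widetilde{\delta\gamma}]=\delta\gamma^\top\nabla^2g(\gamma)\,\widetilde{\delta\gamma}\quad\forall\,\delta\gamma,\widetilde{\delta\gamma}\in H^1(0,T;\mathbb{R}^2),$$ where $g'$ and $\nabla^2g$ denote the Jacobian and the Hessian of $g$ and the right-hand sides are understood pointwise in $t\in[0,T]$.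
   Context: The standing assumptions on $g$ are: $g:\mathbb{R}^2\to\mathbb{R}$ is $C^3$; the set $\Gamma_S=\{x\in\mathbb{R}^2:g(x)\le0\}$ is non-empty and compact; and $g'(x)\neq0$ for all $x$ with $g(x)=0$. Elements of $H^1(0,T)$ and $H^1(0,T;\mathbb{R}^2)$ are identified with their continuous representatives on $[0,T]$. *)

theory Defs
  imports "HOL-Analysis.Analysis" "HOL-Library.Function_Algebras"
begin

instantiation "fun" :: (type, real_vector) real_vector
begin

definition "c *\<^sub>R f = (\<lambda>x. c *\<^sub>R f x)"

instance
  by standard (auto simp: scaleR_fun_def fun_eq_iff algebra_simps)

end

text \<open>
  The spaces depend on the real parameter \<open>T\<close> and hence cannot be types: a normed space is a
  linear subspace of an ambient real vector space, together with a norm that is meaningful on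
  that subspace only.  Functions defined on a proper subset \<open>S\<close> of a type are represented by their
  extension by zero, so that equality of representatives is equality on \<open>S\<close>.
\<close>

record 'a nspace =
  carrier :: "'a set"
  nrm :: "'a \<Rightarrow> real"

definition zero_ext :: "'a set \<Rightarrow> ('a \<Rightarrow> 'b::zero) \<Rightarrow> 'a \<Rightarrow> 'b" where
  "zero_ext S f = (\<lambda>x. if x \<in> S then f x else 0)"

definition continuous_map_nspace ::
    "'a::real_vector nspace \<Rightarrow> 'b::real_vector nspace \<Rightarrow> ('a \<Rightarrow> 'b) \<Rightarrow> bool" where
  "continuous_map_nspace V W F \<longleftrightarrow>
     F ` carrier V \<subseteq> carrier W \<and>
     (\<forall>x\<in>carrier V. \<forall>\<epsilon>>0. \<exists>\<delta>>0. \<forall>y\<in>carrier V.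
        nrm V (y - x) < \<delta> \<longrightarrow> nrm W (F y - F x) < \<epsilon>)"

definition bounded_operator ::
    "'a::real_vector nspace \<Rightarrow> 'b::real_vector nspace \<Rightarrow> ('a \<Rightarrow> 'b) \<Rightarrow> bool" where
  "bounded_operator V W A \<longleftrightarrow>
     A ` carrier V \<subseteq> carrier W \<and>
     (\<forall>x\<in>carrier V. \<forall>y\<in>carrier V. A (x + y) = A x + A y) \<and>
     (\<forall>c. \<forall>x\<in>carrier V. A (c *\<^sub>R x) = c *\<^sub>R A x) \<and>
     (\<exists>K. \<forall>x\<in>carrier V. nrm W (A x) \<le> K * nrm V x)"

text \<open>The space \<open>\<L>(V, W)\<close> of bounded linear operators with the operator norm.\<close>

definition operator_space ::
    "'a::real_vector nspace \<Rightarrow> 'b::real_vector nspace \<Rightarrow> ('a \<Rightarrow> 'b) nspace" where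
  "operator_space V W =
     \<lparr> carrier = {A. bounded_operator V W A \<and> (\<forall>x. x \<notin> carrier V \<longrightarrow> A x = 0)},
       nrm = (\<lambda>A. Sup {nrm W (A x) | x. x \<in> carrier V \<and> nrm V x \<le> 1}) \<rparr>"

definition has_frechet_derivative ::
    "'a::real_vector nspace \<Rightarrow> 'b::real_vector nspace \<Rightarrow> ('a \<Rightarrow> 'b) \<Rightarrow> ('a \<Rightarrow> 'b) \<Rightarrow> 'a \<Rightarrow> bool" where
  "has_frechet_derivative V W F A x \<longleftrightarrow>
     A \<in> carrier (operator_space V W) \<and>
     (\<forall>\<epsilon>>0. \<exists>\<delta>>0. \<forall>h\<in>carrier V.
        nrm V h < \<delta> \<longrightarrow> nrm W (F (x + h) - F x - A h) \<le> \<epsilon> * nrm V h)"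

definition twice_continuously_frechet_differentiable ::
    "'a::real_vector nspace \<Rightarrow> 'b::real_vector nspace \<Rightarrow> ('a \<Rightarrow> 'b) \<Rightarrow> bool" where
  "twice_continuously_frechet_differentiable V W F \<longleftrightarrow>
     F ` carrier V \<subseteq> carrier W \<and>
     (\<exists>F' F''.
        (\<forall>x\<in>carrier V. has_frechet_derivative V W F (F' x) x) \<and>
        (\<forall>x\<in>carrier V. has_frechet_derivative V (operator_space V W) F' (F'' x) x) \<and>
        continuous_map_nspace V (operator_space V W) F' \<and>
        continuous_map_nspace V (operator_space V (operator_space V W)) F'')"

definition square_integrable :: "real \<Rightarrow> (real \<Rightarrow> 'a::euclidean_space) \<Rightarrow> bool" where
  "square_integrable T f \<longleftrightarrow>
     f \<in> borel_measurable (lebesgue_on {0<..<T}) \<and>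
     integrable (lebesgue_on {0<..<T}) (\<lambda>t. (norm (f t))\<^sup>2)"

text \<open>
  Weak derivatives on \<open>(0, T)\<close>, tested as in Brezis' book against the functions in
  \<open>C\<^sub>c\<^sup>1(0, T)\<close>.
\<close>

definition test_function :: "real \<Rightarrow> (real \<Rightarrow> real) \<Rightarrow> bool" where
  "test_function T \<phi> \<longleftrightarrow> \<phi> C1_differentiable_on UNIV \<and> closure {t. \<phi> t \<noteq> 0} \<subseteq> {0<..<T}"

definition has_weak_derivative ::
    "real \<Rightarrow> (real \<Rightarrow> 'a::euclidean_space) \<Rightarrow> (real \<Rightarrow> 'a) \<Rightarrow> bool" where
  "has_weak_derivative T f v \<longleftrightarrow>
     (\<forall>\<phi>. test_function T \<phi> \<longrightarrow>
        (LINT t|lebesgue_on {0<..<T}. deriv \<phi> t *\<^sub>R f t) =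
        - (LINT t|lebesgue_on {0<..<T}. \<phi> t *\<^sub>R v t))"

text \<open>A weak derivative is unique only almost everywhere on \<open>(0, T)\<close>; this selects a version of it.\<close>

definition weak_derivative ::
    "real \<Rightarrow> (real \<Rightarrow> 'a::euclidean_space) \<Rightarrow> real \<Rightarrow> 'a" where
  "weak_derivative T f = (SOME v. square_integrable T v \<and> has_weak_derivative T f v)"

text \<open>
  \<open>H\<^sup>1(0, T)\<close>, with values in a Euclidean space, consisting of the continuous representatives on
  \<open>[0, T]\<close>.
\<close>

definition H1 :: "real \<Rightarrow> (real \<Rightarrow> 'a::euclidean_space) nspace" where
  "H1 T =
     \<lparr> carrier = {f. continuous_on {0..T} f \<and> (\<forall>t. t \<notin> {0..T} \<longrightarrow> f t = 0) \<and>
         square_integrable T f \<and>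
         (\<exists>v. square_integrable T v \<and> has_weak_derivative T f v)},
       nrm = (\<lambda>f. sqrt ((LINT t|lebesgue_on {0<..<T}. (norm (f t))\<^sup>2) +
         (LINT t|lebesgue_on {0<..<T}. (norm (weak_derivative T f t))\<^sup>2))) \<rparr>"

primrec C_k :: "nat \<Rightarrow> ('a::euclidean_space \<Rightarrow> real) \<Rightarrow> bool" where
  "C_k 0 f \<longleftrightarrow> continuous_on UNIV f"
| "C_k (Suc k) f \<longleftrightarrow>
     (\<forall>x. f differentiable (at x)) \<and> (\<forall>v. C_k k (\<lambda>x. frechet_derivative f (at x) v))"

definition partial_derivative :: "'n::finite \<Rightarrow> (real ^ 'n \<Rightarrow> real) \<Rightarrow> real ^ 'n \<Rightarrow> real" where
  "partial_derivative i f x = frechet_derivative f (at x) (axis i 1)"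

definition hessian :: "(real ^ 'n::finite \<Rightarrow> real) \<Rightarrow> real ^ 'n \<Rightarrow> real ^ 'n ^ 'n" where
  "hessian f x = (\<chi> i j. partial_derivative i (partial_derivative j f) x)"

end

theory Submission
  imports Defs
begin

text \<open>
  In one dimension the elements of \<open>H\<^sup>1\<close> are the primitives of square integrable functions. Hence
  \<open>H\<^sup>1\<close> embeds into the bounded functions, is a Banach algebra up to a constant factor, and satisfies
  the chain rule \<open>(\<phi> \<circ> \<gamma>)' = \<phi>' (\<gamma>) \<gamma>'\<close> for \<open>\<phi>\<close> of class \<open>C\<^sup>1\<close>. Consequently \<open>\<gamma> \<mapsto> \<phi> \<circ> \<gamma>\<close> is continuous
  on \<open>H\<^sup>1\<close> if \<open>\<phi>\<close> is \<open>C\<^sup>1\<close> and Frechet differentiable if \<open>\<phi>\<close> is \<open>C\<^sup>2\<close>: both remainders and their weak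
  derivatives are controlled by the uniform continuity of the derivatives of \<open>\<phi>\<close> near the compact
  range of \<open>\<gamma>\<close>. The operators \<open>DG (\<gamma>)\<close> and \<open>D\<^sup>2G (\<gamma>)\<close> multiply the components of their arguments
  by \<open>\<partial>\<^sub>j g \<circ> \<gamma>\<close> and \<open>\<partial>\<^sub>i \<partial>\<^sub>j g \<circ> \<gamma>\<close>, so the claim follows by applying these facts to the partial
  derivatives of \<open>g\<close>.
\<close>

section \<open>Differentiable functions on Euclidean spaces\<close>

text \<open>The hypothesis \<open>C_k 3 g\<close> comes from a count of derivatives: the weak
  derivative of \<open>\<phi> \<circ> \<gamma>\<close> already contains \<open>\<phi>'\<close>, so
  continuity of a superposition costs one derivative and differentiability two. Differentiability of
  \<open>DG\<close> spends two on the first partial derivatives of \<open>g\<close>, continuity of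
  \<open>D2G\<close> one on the second partial derivatives. The obstacle is that weak derivatives
  are merely square integrable. An increment \<open>h\<close> that is small in H1 is small uniformly
  in \<open>t\<close>, but the derivatives of \<open>\<gamma>\<close> and of \<open>h\<close> are
  controlled in L2 alone. Hence each error in a weak derivative has to be a factor that is small
  uniformly in \<open>t\<close>, times the norm of one of these derivatives. This is why the
  pointwise estimates are uniform over a compact set and proportional to the length of the direction
  vector. Moreover the norm of \<open>H1\<close> refers to a chosen version of the weak derivative.
  The predicate \<open>is_primitive\<close> carries an explicit derivative along with the function,
  and uniqueness almost everywhere makes the norm computable from it. Constants such as the 4 in
  \<open>nrm_H1_add\<close> are not sharp; what matters is that they do not depend on the
  functions.\<close>

definition C1_deriv :: "('a::euclidean_space \<Rightarrow> 'b::euclidean_space) \<Rightarrow> ('a \<Rightarrow> 'a \<Rightarrow> 'b) \<Rightarrow> bool" where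
  "C1_deriv \<phi> \<phi>' \<longleftrightarrow>
     (\<forall>x. (\<phi> has_derivative \<phi>' x) (at x)) \<and> (\<forall>v. continuous_on UNIV (\<lambda>x. \<phi>' x v))"

lemma C1_deriv_linear: "C1_deriv \<phi> \<phi>' \<Longrightarrow> linear (\<phi>' x)"
  unfolding C1_deriv_def using has_derivative_linear by blast

lemma linear_eq_sum_Basis:
  fixes L :: "'a::euclidean_space \<Rightarrow> 'b::euclidean_space"
  assumes "linear L"
  shows "L v = (\<Sum>b\<in>Basis. (v \<bullet> b) *\<^sub>R L b)"
  using linear_sum[OF assms, of "\<lambda>b. (v \<bullet> b) *\<^sub>R b" Basis]
  by (simp add: euclidean_representation linear_cmul[OF assms])

lemma linear_norm_le_sum_Basis:
  fixes L :: "'a::euclidean_space \<Rightarrow> 'b::euclidean_space"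
  assumes "linear L"
  shows "norm (L v) \<le> (\<Sum>b\<in>Basis. norm (L b)) * norm v"
proof -
  have "L v = (\<Sum>b\<in>Basis. (v \<bullet> b) *\<^sub>R L b)"
    by (rule linear_eq_sum_Basis[OF assms])
  also have "norm \<dots> \<le> (\<Sum>b\<in>Basis. norm v * norm (L b))"
    by (rule sum_norm_le) (auto intro!: mult_right_mono Basis_le_norm)
  finally show ?thesis
    by (simp add: sum_distrib_left mult.commute)
qed

text \<open>Since \<open>x + y\<close> may leave \<open>K\<close>, uniform continuity is taken on
  the compact sum of \<open>K\<close> and the closed unit ball; a radius of at most 1 keeps both
  points in it.\<close>

lemma continuous_uniform_near_compact:
  fixes f :: "'a::euclidean_space \<Rightarrow> 'b::euclidean_space"
  assumes f: "continuous_on UNIV f" and K: "compact K" and e: "e > 0"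
  obtains d where "d > 0" "\<And>x y. x \<in> K \<Longrightarrow> norm y < d \<Longrightarrow> norm (f (x + y) - f x) \<le> e"
proof -
  define L where "L = {x + y |x y. x \<in> K \<and> y \<in> cball 0 1}"
  have "compact L"
    unfolding L_def using K compact_cball by (rule compact_sums)
  then have "uniformly_continuous_on L f"
    by (intro compact_uniformly_continuous continuous_on_subset[OF f]) auto
  then obtain d where d: "d > 0"
    "\<And>x x'. x \<in> L \<Longrightarrow> x' \<in> L \<Longrightarrow> dist x' x < d \<Longrightarrow> dist (f x') (f x) < e"
    using e by (rule uniformly_continuous_onE) blast
  show thesis
  proof
    show "min d 1 > 0" using d by simp
    fix x y :: 'a assume *: "x \<in> K" "norm y < min d 1"
    have "x \<in> L" using * unfolding L_def by (intro CollectI exI[of _ x] exI[of _ 0]) auto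
    moreover have "x + y \<in> L" using * unfolding L_def by (intro CollectI exI[of _ x] exI[of _ y]) auto
    ultimately show "norm (f (x + y) - f x) \<le> e"
      using d(2)[of x "x + y"] * by (auto simp: dist_norm)
  qed
qed

text \<open>\<open>C1_deriv\<close> provides continuity for each fixed direction only. Uniformity in
  \<open>v\<close> is regained by treating the finitely many basis vectors with tolerance
  \<open>e / n\<close> and using linearity. A bound proportional to \<open>norm v\<close> remains
  useful when an unbounded weak derivative is inserted for \<open>v\<close>.\<close>

lemma C1_deriv_near_compact:
  fixes \<phi> :: "'a::euclidean_space \<Rightarrow> 'b::euclidean_space"
  assumes \<phi>: "C1_deriv \<phi> \<phi>'" and K: "compact K" and e: "e > 0"
  obtains d where "d > 0"
    "\<And>x y v. x \<in> K \<Longrightarrow> norm y < d \<Longrightarrow> norm (\<phi>' (x + y) v - \<phi>' x v) \<le> e * norm v"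
proof -
  define n where "n = real (card (Basis :: 'a set))"
  have n: "n > 0" by (simp add: n_def)
  have "\<forall>b. \<exists>d>0. \<forall>x y. x \<in> K \<longrightarrow> norm y < d \<longrightarrow> norm (\<phi>' (x + y) b - \<phi>' x b) \<le> e / n"
  proof
    fix b
    have "continuous_on UNIV (\<lambda>x. \<phi>' x b)" "e / n > 0"
      using \<phi> e n by (auto simp: C1_deriv_def)
    then show "\<exists>d>0. \<forall>x y. x \<in> K \<longrightarrow> norm y < d \<longrightarrow> norm (\<phi>' (x + y) b - \<phi>' x b) \<le> e / n"
      by (metis K continuous_uniform_near_compact)
  qed
  then obtain D where D: "\<And>b. D b > 0"
    "\<And>b x y. x \<in> K \<Longrightarrow> norm y < D b \<Longrightarrow> norm (\<phi>' (x + y) b - \<phi>' x b) \<le> e / n"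
    by metis
  show thesis
  proof
    show "Min (D ` Basis) > 0" using D(1) by (subst Min_gr_iff) auto
    fix x y v :: 'a assume *: "x \<in> K" "norm y < Min (D ` Basis)"
    have lin: "linear (\<lambda>v. \<phi>' (x + y) v - \<phi>' x v)"
      by (intro linear_compose_sub C1_deriv_linear[OF \<phi>])
    have "norm (\<phi>' (x + y) v - \<phi>' x v) \<le> (\<Sum>b\<in>Basis. norm (\<phi>' (x + y) b - \<phi>' x b)) * norm v"
      by (rule linear_norm_le_sum_Basis[OF lin])
    also have "\<dots> \<le> (\<Sum>b\<in>(Basis::'a set). e / n) * norm v"
      using * by (intro mult_right_mono sum_mono D(2)) auto
    also have "\<dots> = e * norm v"
      using n by (simp add: n_def)
    finally show "norm (\<phi>' (x + y) v - \<phi>' x v) \<le> e * norm v" .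
  qed
qed

text \<open>The mean value inequality for \<open>\<phi> - \<phi>' x\<close> on the ball of radius
  \<open>d\<close>, which is convex. Two displacements are kept because the chain rule compares the
  values at both ends of an interval while the derivative is frozen at a point between them.\<close>

lemma C1_deriv_linearization:
  fixes \<phi> :: "'a::euclidean_space \<Rightarrow> 'b::euclidean_space"
  assumes \<phi>: "C1_deriv \<phi> \<phi>'" and "0 \<le> e"
    and d: "\<And>y v. norm y < d \<Longrightarrow> norm (\<phi>' (x + y) v - \<phi>' x v) \<le> e * norm v"
    and yz: "norm y < d" "norm z < d"
  shows "norm (\<phi> (x + y) - \<phi> (x + z) - \<phi>' x (y - z)) \<le> e * norm (y - z)"
proof -
  have "d > 0"
    using yz(1) by (rule le_less_trans[OF norm_ge_zero])
  have "norm (\<phi> (x + y) - \<phi> (x + z) - \<phi>' x ((x + y) - (x + z))) \<le> norm ((x + y) - (x + z)) * e"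
  proof (rule differentiable_bound_linearization[where S = "ball x d"])
    fix t :: real assume "t \<in> {0..1}"
    then have "(1 - t) *\<^sub>R (x + z) + t *\<^sub>R (x + y) \<in> ball x d"
      using yz by (intro convexD_alt convex_ball) (auto simp: dist_norm)
    also have "(1 - t) *\<^sub>R (x + z) + t *\<^sub>R (x + y) = x + z + t *\<^sub>R (x + y - (x + z))"
      by (simp add: algebra_simps)
    finally show "x + z + t *\<^sub>R (x + y - (x + z)) \<in> ball x d" .
  next
    fix u assume "u \<in> ball x d"
    then have "norm (u - x) < d" by (simp add: dist_norm norm_minus_commute)
    then show "onorm (\<phi>' u - \<phi>' x) \<le> e"
      using d[of "u - x"] \<open>0 \<le> e\<close> by (intro onorm_le) auto
  qed (use \<phi> \<open>d > 0\<close> in \<open>auto simp: C1_deriv_def intro: has_derivative_at_withinI\<close>)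
  then show ?thesis by (simp add: mult.commute)
qed

lemma C1_deriv_bound_compact:
  fixes \<phi> :: "'a::euclidean_space \<Rightarrow> 'b::euclidean_space"
  assumes \<phi>: "C1_deriv \<phi> \<phi>'" and K: "compact K"
  obtains B where "B > 0" "\<And>x v. x \<in> K \<Longrightarrow> norm (\<phi>' x v) \<le> B * norm v"
proof -
  have "continuous_on K (\<lambda>x. \<Sum>b\<in>Basis. norm (\<phi>' x b))"
    using \<phi> by (intro continuous_intros) (auto simp: C1_deriv_def intro: continuous_on_subset)
  then have "bounded ((\<lambda>x. \<Sum>b\<in>Basis. norm (\<phi>' x b)) ` K)"
    using K compact_continuous_image compact_imp_bounded by blast
  then obtain B where B: "B > 0" "\<And>x. x \<in> K \<Longrightarrow> norm (\<Sum>b\<in>Basis. norm (\<phi>' x b)) \<le> B"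
    unfolding bounded_pos by auto
  show thesis
  proof
    fix x v assume "x \<in> K"
    have "norm (\<phi>' x v) \<le> (\<Sum>b\<in>Basis. norm (\<phi>' x b)) * norm v"
      by (rule linear_norm_le_sum_Basis[OF C1_deriv_linear[OF \<phi>]])
    also have "\<dots> \<le> B * norm v"
      using B(2)[OF \<open>x \<in> K\<close>] by (intro mult_right_mono) auto
    finally show "norm (\<phi>' x v) \<le> B * norm v" .
  qed (rule B)
qed

text \<open>Both mixed derivatives are limits of the second difference quotient
  \<open>(\<phi> (x + s u + s w) - \<phi> (x + s u) - \<phi> (x + s w) + \<phi> x) / s\<^sup>2\<close>.\<close>

lemma second_difference_tendsto:
  fixes \<phi> :: "'a::euclidean_space \<Rightarrow> real"
  assumes \<phi>: "C1_deriv \<phi> \<phi>'" and \<phi>': "C1_deriv (\<lambda>x. \<phi>' x u) \<phi>''" and "e > 0"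
  obtains d where "d > 0"
    "\<And>s. 0 < s \<Longrightarrow> s < d \<Longrightarrow>
      \<bar>\<phi> (x + s *\<^sub>R u + s *\<^sub>R w) - \<phi> (x + s *\<^sub>R u) - \<phi> (x + s *\<^sub>R w) + \<phi> x - s\<^sup>2 * \<phi>'' x w\<bar> \<le> e * s\<^sup>2"
proof -
  \<comment> \<open>The linearisation below costs \<open>c * (s * norm w)\<close>, which has to stay
    below \<open>e * s\<close>; the \<open>+ 1\<close> covers \<open>w = 0\<close>.\<close>
  define c where "c = e / (norm w + 1)"
  have w: "norm w + 1 > 0" by (smt (verit) norm_ge_zero)
  then have c: "c > 0" using \<open>e > 0\<close> by (simp add: c_def)
  obtain d where d: "d > 0" and "\<And>y v. norm y < d \<Longrightarrow> norm (\<phi>'' (x + y) v - \<phi>'' x v) \<le> c * norm v"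
    by (metis C1_deriv_near_compact[OF \<phi>' _ c, of "{x}"] compact_sing singletonI)
  then have lin: "\<bar>\<phi>' (x + y) u - \<phi>' (x + z) u - \<phi>'' x (y - z)\<bar> \<le> c * norm (y - z)"
    if "norm y < d" "norm z < d" for y z
    using C1_deriv_linearization[OF \<phi>', of c d x y z] c that by simp
  \<comment> \<open>For \<open>0 < r < s < d'\<close> the displacements \<open>r *\<^sub>R u\<close>
    and \<open>r *\<^sub>R u + s *\<^sub>R w\<close> are shorter than \<open>d\<close>, so that
    \<open>lin\<close> applies to them.\<close>
  define d' where "d' = d / (norm u + norm w + 1)"
  have pos: "norm u + norm w + 1 > 0" by (smt (verit) norm_ge_zero)
  show thesis
  proof
    show "d' > 0" using d pos by (simp add: d'_def)
    fix s :: real assume s: "0 < s" "s < d'"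
    have sd: "s * (norm u + norm w + 1) < d"
      using s(2) pos by (simp add: d'_def pos_less_divide_eq)
    \<comment> \<open>The second difference is the increment of \<open>F\<close> over
      \<open>{0..s}\<close>: the mean value theorem for \<open>F\<close> uses up the direction
      \<open>u\<close>, and linearising the derivative in direction \<open>u\<close> then uses up
      \<open>w\<close>.\<close>
    define F where "F r = \<phi> (x + r *\<^sub>R u + s *\<^sub>R w) - \<phi> (x + r *\<^sub>R u)" for r
    have F: "(F has_derivative (\<lambda>k. k * (\<phi>' (x + r *\<^sub>R u + s *\<^sub>R w) u - \<phi>' (x + r *\<^sub>R u) u))) (at r within {0..s})" for r
    proof -
      have der: "((\<lambda>r. \<phi> (z + r *\<^sub>R u)) has_derivative (\<lambda>k. \<phi>' (z + r *\<^sub>R u) (k *\<^sub>R u))) (at r within {0..s})" for z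
        using \<phi> by (intro has_derivative_compose[where g = \<phi>, of "\<lambda>r. z + r *\<^sub>R u"])
          (auto intro!: derivative_eq_intros simp: C1_deriv_def)
      from has_derivative_diff[OF der[of "x + s *\<^sub>R w"] der[of x]] show ?thesis
        unfolding F_def
        by (simp add: add_ac linear_cmul[OF C1_deriv_linear[OF \<phi>]] right_diff_distrib)
    qed
    obtain r where r: "r \<in> {0<..<s}"
      and eq: "F s - F 0 = (s - 0) * (\<phi>' (x + r *\<^sub>R u + s *\<^sub>R w) u - \<phi>' (x + r *\<^sub>R u) u)"
      using mvt_simple[OF \<open>0 < s\<close> F] by blast
    have n: "norm (r *\<^sub>R u) \<le> s * norm u" using r by (auto intro: mult_right_mono)
    have n1: "norm (r *\<^sub>R u) < d"
      using n sd s by (smt (verit) distrib_left mult_nonneg_nonneg norm_ge_zero)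
    have n2: "norm (r *\<^sub>R u + s *\<^sub>R w) < d"
      using n norm_triangle_ineq[of "r *\<^sub>R u" "s *\<^sub>R w"] sd s by (simp add: distrib_left)
    have "\<bar>\<phi>' (x + r *\<^sub>R u + s *\<^sub>R w) u - \<phi>' (x + r *\<^sub>R u) u - s * \<phi>'' x w\<bar> \<le> c * (s * norm w)"
      using lin[OF n2 n1] s by (simp add: add_ac linear_cmul[OF C1_deriv_linear[OF \<phi>']])
    also have "\<dots> \<le> e * s"
    proof -
      have "c * norm w \<le> e" using w \<open>e > 0\<close> by (simp add: c_def field_simps)
      then show ?thesis using mult_right_mono[of "c * norm w" e s] s by (simp add: mult_ac)
    qed
    finally have "s * \<bar>\<phi>' (x + r *\<^sub>R u + s *\<^sub>R w) u - \<phi>' (x + r *\<^sub>R u) u - s * \<phi>'' x w\<bar> \<le> s * (e * s)"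
      using s by (intro mult_left_mono) auto
    also have "s * \<bar>\<phi>' (x + r *\<^sub>R u + s *\<^sub>R w) u - \<phi>' (x + r *\<^sub>R u) u - s * \<phi>'' x w\<bar>
        = \<bar>F s - F 0 - s\<^sup>2 * \<phi>'' x w\<bar>"
      using s eq by (simp add: abs_mult_pos' power2_eq_square right_diff_distrib mult.assoc)
    finally show "\<bar>\<phi> (x + s *\<^sub>R u + s *\<^sub>R w) - \<phi> (x + s *\<^sub>R u) - \<phi> (x + s *\<^sub>R w) + \<phi> x - s\<^sup>2 * \<phi>'' x w\<bar> \<le> e * s\<^sup>2"
      by (simp add: F_def power2_eq_square mult_ac algebra_simps)
  qed
qed

text \<open>The second difference does not change when \<open>u\<close> and \<open>w\<close> are
  exchanged. At a common small \<open>s\<close>, both mixed derivatives times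
  \<open>s\<^sup>2\<close> are within \<open>e / 2 * s\<^sup>2\<close> of it, and
  \<open>s\<^sup>2\<close> cancels.\<close>

lemma symmetric_second_derivative:
  fixes \<phi> :: "'a::euclidean_space \<Rightarrow> real"
  assumes \<phi>: "C1_deriv \<phi> \<phi>'" and \<phi>': "\<And>v. C1_deriv (\<lambda>x. \<phi>' x v) (\<phi>'' v)"
  shows "\<phi>'' u x w = \<phi>'' w x u"
proof -
  have "\<bar>\<phi>'' u x w - \<phi>'' w x u\<bar> \<le> 0 + e" if "e > 0" for e
  proof -
    have e: "e / 2 > 0" using that by simp
    obtain d1 where d1: "d1 > 0" "\<And>s. 0 < s \<Longrightarrow> s < d1 \<Longrightarrow>
      \<bar>\<phi> (x + s *\<^sub>R u + s *\<^sub>R w) - \<phi> (x + s *\<^sub>R u) - \<phi> (x + s *\<^sub>R w) + \<phi> x - s\<^sup>2 * \<phi>'' u x w\<bar> \<le> e / 2 * s\<^sup>2"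
      using second_difference_tendsto[OF \<phi> \<phi>' e] by metis
    obtain d2 where d2: "d2 > 0" "\<And>s. 0 < s \<Longrightarrow> s < d2 \<Longrightarrow>
      \<bar>\<phi> (x + s *\<^sub>R w + s *\<^sub>R u) - \<phi> (x + s *\<^sub>R w) - \<phi> (x + s *\<^sub>R u) + \<phi> x - s\<^sup>2 * \<phi>'' w x u\<bar> \<le> e / 2 * s\<^sup>2"
      using second_difference_tendsto[OF \<phi> \<phi>' e] by metis
    define s where "s = min d1 d2 / 2"
    have s: "0 < s" "s < d1" "s < d2" using d1(1) d2(1) by (auto simp: s_def min_def)
    have "\<bar>s\<^sup>2 * \<phi>'' u x w - s\<^sup>2 * \<phi>'' w x u\<bar> \<le> e * s\<^sup>2"
      using d1(2)[OF s(1,2)] d2(2)[OF s(1,3)] add.commute[of "s *\<^sub>R w" "s *\<^sub>R u"]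
      unfolding add.assoc by (smt (verit) field_sum_of_halves distrib_right)
    then have "s\<^sup>2 * \<bar>\<phi>'' u x w - \<phi>'' w x u\<bar> \<le> s\<^sup>2 * e"
      by (simp add: abs_mult mult.commute[of e] flip: right_diff_distrib)
    then show ?thesis using s by simp
  qed
  then have "\<bar>\<phi>'' u x w - \<phi>'' w x u\<bar> \<le> 0" by (rule field_le_epsilon)
  then show ?thesis by simp
qed

section \<open>Square integrable functions and their primitives\<close>

text \<open>The definition of H1 integrates over the open interval, while the calculus of gauge
  integrals is used on the closed one; the end points are a null set.\<close>

lemma set_integrable_iff_lebesgue_on_Ioo:
  fixes f :: "real \<Rightarrow> 'a::euclidean_space"
  shows "f absolutely_integrable_on {a..b} \<longleftrightarrow> integrable (lebesgue_on {a<..<b}) f"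
  by (simp add: absolutely_integrable_on_Icc_iff_Ioo set_integrable_eq)

lemma lebesgue_on_Ioo_eq_integral:
  fixes f :: "real \<Rightarrow> 'a::euclidean_space"
  assumes "f absolutely_integrable_on {a..b}"
  shows "(LINT t|lebesgue_on {a<..<b}. f t) = integral {a..b} f"
  using assms lebesgue_integral_eq_integral[of "{a<..<b}" f]
  by (simp add: set_integrable_iff_lebesgue_on_Ioo integral_open_interval_real)

lemma continuous_on_borel_measurable_Ioo:
  fixes f :: "real \<Rightarrow> 'a::euclidean_space"
  assumes "continuous_on {a..b} f"
  shows "f \<in> borel_measurable (lebesgue_on {a<..<b})"
  by (intro continuous_imp_measurable_on_sets_lebesgue continuous_on_subset[OF assms]) auto

lemma absolutely_integrable_continuous_Icc:
  fixes f :: "real \<Rightarrow> 'a::euclidean_space"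
  assumes "continuous_on {a..b} f"
  shows "f absolutely_integrable_on {a..b}"
  using absolutely_integrable_continuous[of a b f] assms by simp

lemma integrable_const_Ioo [simp]:
  fixes c :: "'a::euclidean_space"
  shows "integrable (lebesgue_on {a<..<b::real}) (\<lambda>t. c)"
  by (simp flip: set_integrable_iff_lebesgue_on_Ioo)

definition L2_norm :: "real \<Rightarrow> (real \<Rightarrow> 'a::euclidean_space) \<Rightarrow> real" where
  "L2_norm T f = sqrt (LINT t|lebesgue_on {0<..<T}. (norm (f t))\<^sup>2)"

lemma L2_norm_nonneg: "0 \<le> L2_norm T f"
  by (simp add: L2_norm_def)

lemma L2_norm_power2: "(L2_norm T f)\<^sup>2 = (LINT t|lebesgue_on {0<..<T}. (norm (f t))\<^sup>2)"
  by (simp add: L2_norm_def)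

text \<open>Squaring the pointwise bound and using
  \<open>(a + b)\<^sup>2 \<le> 2 * a\<^sup>2 + 2 * b\<^sup>2\<close> yields membership and estimate
  at once, at the price of the factor 2. Only norms are compared, so \<open>p\<close> and
  \<open>q\<close> may take values in other spaces than \<open>w\<close>. The L2 estimates of weak
  derivatives all pass through this lemma.\<close>

lemma square_integrable_dominated:
  fixes w :: "real \<Rightarrow> 'a::euclidean_space" and p :: "real \<Rightarrow> 'b::euclidean_space"
    and q :: "real \<Rightarrow> 'c::euclidean_space"
  assumes w: "w \<in> borel_measurable (lebesgue_on {0<..<T})"
    and p: "square_integrable T p" and q: "square_integrable T q"
    and nonneg: "0 \<le> B" "0 \<le> C"
    and le: "\<And>t. t \<in> {0<..<T} \<Longrightarrow> norm (w t) \<le> B * norm (p t) + C * norm (q t)"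
  shows "square_integrable T w" "L2_norm T w \<le> 2 * B * L2_norm T p + 2 * C * L2_norm T q"
proof -
  have ineq: "(norm (w t))\<^sup>2 \<le> 2 * B\<^sup>2 * (norm (p t))\<^sup>2 + 2 * C\<^sup>2 * (norm (q t))\<^sup>2"
    if "t \<in> {0<..<T}" for t
  proof -
    have "(norm (w t))\<^sup>2 \<le> (B * norm (p t) + C * norm (q t))\<^sup>2"
      using le[OF that] by (intro power_mono) auto
    also have "\<dots> \<le> 2 * (B * norm (p t))\<^sup>2 + 2 * (C * norm (q t))\<^sup>2"
      using sum_squares_ge_zero[of "B * norm (p t) - C * norm (q t)" 0]
      by (simp add: power2_eq_square algebra_simps)
    finally show ?thesis by (simp add: power_mult_distrib)
  qed
  have int: "integrable (lebesgue_on {0<..<T}) (\<lambda>t. 2 * B\<^sup>2 * (norm (p t))\<^sup>2 + 2 * C\<^sup>2 * (norm (q t))\<^sup>2)"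
    using p q by (auto simp: square_integrable_def)
  have "integrable (lebesgue_on {0<..<T}) (\<lambda>t. (norm (w t))\<^sup>2)"
  proof (rule Bochner_Integration.integrable_bound[OF int])
    show "(\<lambda>t. (norm (w t))\<^sup>2) \<in> borel_measurable (lebesgue_on {0<..<T})"
      using w by measurable
    show "AE t in lebesgue_on {0<..<T}. norm ((norm (w t))\<^sup>2)
        \<le> norm (2 * B\<^sup>2 * (norm (p t))\<^sup>2 + 2 * C\<^sup>2 * (norm (q t))\<^sup>2)"
      using ineq by (intro AE_I2) (auto intro: order_trans)
  qed
  then show sq: "square_integrable T w"
    using w by (simp add: square_integrable_def)
  have "(L2_norm T w)\<^sup>2 \<le>
      (LINT t|lebesgue_on {0<..<T}. 2 * B\<^sup>2 * (norm (p t))\<^sup>2 + 2 * C\<^sup>2 * (norm (q t))\<^sup>2)"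
    unfolding L2_norm_power2
    using sq int ineq by (intro integral_mono) (auto simp: square_integrable_def)
  also have "\<dots> = 2 * B\<^sup>2 * (L2_norm T p)\<^sup>2 + 2 * C\<^sup>2 * (L2_norm T q)\<^sup>2"
    using p q unfolding L2_norm_power2 by (simp add: square_integrable_def)
  also have "\<dots> \<le> (2 * B * L2_norm T p + 2 * C * L2_norm T q)\<^sup>2"
  proof -
    have "0 \<le> (B * L2_norm T p) * (C * L2_norm T q)"
      using nonneg L2_norm_nonneg by (meson mult_nonneg_nonneg)
    moreover have "0 \<le> B\<^sup>2 * (L2_norm T p)\<^sup>2" "0 \<le> C\<^sup>2 * (L2_norm T q)\<^sup>2" by auto
    ultimately show ?thesis by (simp add: power2_eq_square algebra_simps)
  qed
  finally show "L2_norm T w \<le> 2 * B * L2_norm T p + 2 * C * L2_norm T q"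
    by (rule power2_le_imp_le) (simp add: nonneg L2_norm_nonneg)
qed

lemma square_integrable_continuous:
  fixes f :: "real \<Rightarrow> 'a::euclidean_space"
  assumes "continuous_on {0..T} f"
  shows "square_integrable T f"
proof -
  have "(\<lambda>t. (norm (f t))\<^sup>2) absolutely_integrable_on {0..T}"
    by (intro absolutely_integrable_continuous_Icc continuous_intros assms)
  then show ?thesis
    using continuous_on_borel_measurable_Ioo[OF assms]
    by (simp add: square_integrable_def set_integrable_iff_lebesgue_on_Ioo)
qed

lemma square_integrable_imp_absolutely_integrable:
  assumes "square_integrable T v"
  shows "v absolutely_integrable_on {0..T}"
proof -
  have "integrable (lebesgue_on {0<..<T}) v"
  proof (rule Bochner_Integration.integrable_bound)
    show "integrable (lebesgue_on {0<..<T}) (\<lambda>t. 1 + (norm (v t))\<^sup>2)"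
      using assms by (auto simp: square_integrable_def)
    have "norm (v t) \<le> 1 + (norm (v t))\<^sup>2" for t
    proof -
      have "2 * norm (v t) \<le> 1 + (norm (v t))\<^sup>2"
        using zero_le_power2[of "norm (v t) - 1"] by (simp add: power2_diff)
      then show ?thesis using norm_ge_zero[of "v t"] by linarith
    qed
    then show "AE t in lebesgue_on {0<..<T}. norm (v t) \<le> norm (1 + (norm (v t))\<^sup>2)"
      by (intro AE_I2) (simp add: abs_of_nonneg)
  qed (use assms in \<open>simp add: square_integrable_def\<close>)
  then show ?thesis by (simp add: set_integrable_iff_lebesgue_on_Ioo)
qed

text \<open>Cauchy-Schwarz, from the nonnegative variance of \<open>norm \<circ> v\<close>.\<close>

lemma integral_norm_le_L2_norm:
  assumes v: "square_integrable T v" and "T > 0"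
  shows "integral {0..T} (\<lambda>t. norm (v t)) \<le> sqrt T * L2_norm T v"
proof -
  let ?M = "lebesgue_on {0<..<T}"
  define m where "m = (LINT t|?M. norm (v t)) / T"
  have int: "integrable ?M v"
    using square_integrable_imp_absolutely_integrable[OF v] by (simp add: set_integrable_iff_lebesgue_on_Ioo)
  have int2: "integrable ?M (\<lambda>t. (norm (v t))\<^sup>2)"
    using v by (simp add: square_integrable_def)

  have "0 \<le> (LINT t|?M. (norm (v t) - m)\<^sup>2)"
    by simp
  also have "\<dots> = (LINT t|?M. (norm (v t))\<^sup>2 - 2 * m * norm (v t) + m\<^sup>2)"
    by (intro Bochner_Integration.integral_cong) (auto simp: power2_diff)
  also have "\<dots> = (L2_norm T v)\<^sup>2 - 2 * m * (LINT t|?M. norm (v t)) + T * m\<^sup>2"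
    using int int2 \<open>T > 0\<close> by (simp add: L2_norm_power2 measure_restrict_space)
  also have "\<dots> = (L2_norm T v)\<^sup>2 - (LINT t|?M. norm (v t))\<^sup>2 / T"
    using \<open>T > 0\<close> by (simp add: m_def power2_eq_square field_simps)
  finally have "(LINT t|?M. norm (v t))\<^sup>2 \<le> (sqrt T * L2_norm T v)\<^sup>2"
    using \<open>T > 0\<close> by (simp add: power_mult_distrib field_simps)
  then have "(LINT t|?M. norm (v t)) \<le> sqrt T * L2_norm T v"
    by (rule power2_le_imp_le) (use \<open>T > 0\<close> in \<open>simp add: L2_norm_nonneg\<close>)
  then show ?thesis
    using int lebesgue_on_Ioo_eq_integral[where f = "\<lambda>t. norm (v t)" and a = 0 and b = T]
    by (simp add: set_integrable_iff_lebesgue_on_Ioo)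
qed

text \<open>Absolute continuity with a square integrable derivative, where the derivative is named
  instead of chosen. Only the values of \<open>f\<close> on \<open>{0..T}\<close> matter, so the
  same \<open>v\<close> serves \<open>f\<close> and its extension by zero.\<close>

definition is_primitive :: "real \<Rightarrow> (real \<Rightarrow> 'a::euclidean_space) \<Rightarrow> (real \<Rightarrow> 'a) \<Rightarrow> bool" where
  "is_primitive T f v \<longleftrightarrow>
     square_integrable T v \<and> (\<forall>t\<in>{0..T}. f t = f 0 + integral {0..t} v)"

lemma is_primitive_increment:
  assumes f: "is_primitive T f v" and "0 \<le> a" "a \<le> b" "b \<le> T"
  shows "f b - f a = integral {a..b} v"
proof -
  have "v integrable_on {0..T}"
    using f by (simp add: is_primitive_def square_integrable_imp_absolutely_integrable set_lebesgue_integral_eq_integral(1))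
  then have "v integrable_on {0..b}"
    by (rule integrable_subinterval_real) (use assms in auto)
  then have "integral {0..a} v + integral {a..b} v = integral {0..b} v"
    using assms by (intro Henstock_Kurzweil_Integration.integral_combine) auto
  moreover have "f a = f 0 + integral {0..a} v" "f b = f 0 + integral {0..b} v"
    using assms unfolding is_primitive_def by (meson atLeastAtMost_iff order_trans)+
  ultimately show ?thesis by (metis add_diff_cancel_left add_diff_cancel_left' add.assoc)
qed

lemma is_primitive_continuous_on:
  assumes f: "is_primitive T f v"
  shows "continuous_on {0..T} f"
proof -
  have "v integrable_on {0..T}"
    using f by (simp add: is_primitive_def square_integrable_imp_absolutely_integrable set_lebesgue_integral_eq_integral(1))
  then have "continuous_on {0..T} (\<lambda>t. f 0 + integral {0..t} v)"
    by (intro continuous_intros indefinite_integral_continuous_1)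
  then show ?thesis
    by (rule continuous_on_eq) (use f in \<open>metis is_primitive_def\<close>)
qed

text \<open>Expanding \<open>v t\<close> in the basis leaves products of a measurable coefficient
  and a continuous function of \<open>t\<close>, since \<open>\<phi>'\<close> is continuous in the
  base point for each fixed direction.\<close>

lemma C1_deriv_measurable:
  fixes \<gamma> v :: "real \<Rightarrow> 'a::euclidean_space"
  assumes \<phi>: "C1_deriv \<phi> \<phi>'" and g: "continuous_on {0..T} \<gamma>"
    and v: "v \<in> borel_measurable (lebesgue_on {0<..<T})"
  shows "(\<lambda>t. \<phi>' (\<gamma> t) (v t)) \<in> borel_measurable (lebesgue_on {0<..<T})"
proof -
  have "\<phi>' (\<gamma> t) (v t) = (\<Sum>b\<in>Basis. (v t \<bullet> b) *\<^sub>R \<phi>' (\<gamma> t) b)" for t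
    by (rule linear_eq_sum_Basis[OF C1_deriv_linear[OF \<phi>]])
  moreover have "(\<lambda>t. \<phi>' (\<gamma> t) b) \<in> borel_measurable (lebesgue_on {0<..<T})" for b
  proof (rule continuous_on_borel_measurable_Ioo)
    show "continuous_on {0..T} (\<lambda>t. \<phi>' (\<gamma> t) b)"
      by (rule continuous_on_compose2[OF _ g, of UNIV]) (use \<phi> in \<open>auto simp: C1_deriv_def\<close>)
  qed
  ultimately show ?thesis using v by simp
qed

text \<open>A bisection argument: the defect of the integrated chain rule is additive when adjacent
  intervals are glued, and on a short interval it is at most \<open>e\<close> times the integral of
  \<open>norm (v s)\<close>, because \<open>\<gamma>\<close> stays in a ball on which
  \<open>\<phi>\<close> is nearly affine. The same bound therefore holds on \<open>{0..t}\<close>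
  for every \<open>e > 0\<close>, and the defect is zero.\<close>

lemma is_primitive_chain_rule:
  fixes \<phi> :: "'a::euclidean_space \<Rightarrow> 'b::euclidean_space"
  assumes \<phi>: "C1_deriv \<phi> \<phi>'" and g: "is_primitive T \<gamma> v"
  shows "is_primitive T (\<lambda>t. \<phi> (\<gamma> t)) (\<lambda>t. \<phi>' (\<gamma> t) (v t))"
proof -
  define w where "w t = \<phi>' (\<gamma> t) (v t)" for t
  have cont: "continuous_on {0..T} \<gamma>" by (rule is_primitive_continuous_on[OF g])
  have v: "square_integrable T v" using g by (simp add: is_primitive_def)
  have "compact (\<gamma> ` {0..T})" using cont by (intro compact_continuous_image) auto
  then obtain B where B: "B > 0" "\<And>x u. x \<in> \<gamma> ` {0..T} \<Longrightarrow> norm (\<phi>' x u) \<le> B * norm u"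
    using C1_deriv_bound_compact[OF \<phi>] by blast
  have w: "square_integrable T w"
  proof (rule square_integrable_dominated(1)[OF _ v v])
    show "w \<in> borel_measurable (lebesgue_on {0<..<T})"
      unfolding w_def[abs_def] using v by (intro C1_deriv_measurable[OF \<phi> cont]) (simp add: square_integrable_def)
    show "norm (w t) \<le> B * norm (v t) + 0 * norm (v t)" if "t \<in> {0<..<T}" for t
      using B(2)[of "\<gamma> t" "v t"] that by (auto simp: w_def)
  qed (use B in auto)
  have iv: "v absolutely_integrable_on {a..b}" if "0 \<le> a" "b \<le> T" for a b
    by (rule absolutely_integrable_on_subinterval[OF square_integrable_imp_absolutely_integrable[OF v]])
      (use that in auto)
  have iw: "w absolutely_integrable_on {a..b}" if "0 \<le> a" "b \<le> T" for a b
    by (rule absolutely_integrable_on_subinterval[OF square_integrable_imp_absolutely_integrable[OF w]])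
      (use that in auto)
  have est: "norm (\<phi> (\<gamma> t) - \<phi> (\<gamma> 0) - integral {0..t} w) \<le> e * integral {0..t} (\<lambda>s. norm (v s))"
    if t: "t \<in> {0..T}" and "e > 0" for t e
  proof -
    \<comment> \<open>The guard is part of \<open>P\<close> because the local case of
      \<open>Bolzano\<close> ranges over all short intervals around \<open>x\<close>, including
      those that leave \<open>{0..T}\<close>.\<close>
    define P where "P a b \<longleftrightarrow> (0 \<le> a \<and> b \<le> T \<longrightarrow>
      norm (\<phi> (\<gamma> b) - \<phi> (\<gamma> a) - integral {a..b} w) \<le> e * integral {a..b} (\<lambda>s. norm (v s)))" for a b
    have "0 \<le> t" using t by simp
    then have "P 0 t"
    proof (induction rule: Bolzano)
      case (trans a b c)
      show ?case unfolding P_def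
      proof
        assume ac: "0 \<le> a \<and> c \<le> T"
        have "integral {a..b} w + integral {b..c} w = integral {a..c} w"
          using trans(3,4) iw[of a c] ac
          by (intro Henstock_Kurzweil_Integration.integral_combine) (auto simp: absolutely_integrable_on_def)
        moreover have "integral {a..b} (\<lambda>s. norm (v s)) + integral {b..c} (\<lambda>s. norm (v s)) = integral {a..c} (\<lambda>s. norm (v s))"
          using trans(3,4) iv[of a c] ac
          by (intro Henstock_Kurzweil_Integration.integral_combine) (auto simp: absolutely_integrable_on_def)
        moreover have "norm (\<phi> (\<gamma> b) - \<phi> (\<gamma> a) - integral {a..b} w) \<le> e * integral {a..b} (\<lambda>s. norm (v s))"
          using trans(1,4) ac by (simp add: P_def)
        moreover have "norm (\<phi> (\<gamma> c) - \<phi> (\<gamma> b) - integral {b..c} w) \<le> e * integral {b..c} (\<lambda>s. norm (v s))"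
          using trans(2,3) ac by (simp add: P_def)
        moreover have "norm (X + Y) \<le> x + y" if "norm X \<le> x" "norm Y \<le> y" for X Y :: 'b and x y
          using that norm_triangle_ineq[of X Y] by linarith
        ultimately have "norm ((\<phi> (\<gamma> b) - \<phi> (\<gamma> a) - integral {a..b} w) + (\<phi> (\<gamma> c) - \<phi> (\<gamma> b) - integral {b..c} w))
            \<le> e * integral {a..b} (\<lambda>s. norm (v s)) + e * integral {b..c} (\<lambda>s. norm (v s))"
          by blast
        also have "(\<phi> (\<gamma> b) - \<phi> (\<gamma> a) - integral {a..b} w) + (\<phi> (\<gamma> c) - \<phi> (\<gamma> b) - integral {b..c} w)
            = \<phi> (\<gamma> c) - \<phi> (\<gamma> a) - (integral {a..b} w + integral {b..c} w)"
          by simp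
        finally show "norm (\<phi> (\<gamma> c) - \<phi> (\<gamma> a) - integral {a..c} w) \<le> e * integral {a..c} (\<lambda>s. norm (v s))"
          using \<open>integral {a..b} w + integral {b..c} w = integral {a..c} w\<close>
            \<open>integral {a..b} (\<lambda>s. norm (v s)) + integral {b..c} (\<lambda>s. norm (v s)) = integral {a..c} (\<lambda>s. norm (v s))\<close>
          by (simp flip: distrib_left)
      qed
    next
      case (local x)
      \<comment> \<open>One half of \<open>e\<close> pays for replacing the increment of
        \<open>\<phi>\<close> by \<open>\<phi>' (\<gamma> x)\<close>, the other for replacing
        \<open>\<phi>' (\<gamma> s)\<close> by \<open>\<phi>' (\<gamma> x)\<close> in the integral
        of \<open>w\<close>.\<close>
      have e: "e / 2 > 0" using \<open>e > 0\<close> by simp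
      obtain d where d: "d > 0"
        "\<And>y u. norm y < d \<Longrightarrow> norm (\<phi>' (\<gamma> x + y) u - \<phi>' (\<gamma> x) u) \<le> e / 2 * norm u"
        by (metis C1_deriv_near_compact[OF \<phi> _ e, of "{\<gamma> x}"] compact_sing singletonI)
      obtain d' where d': "d' > 0" "\<And>s. s \<in> {0..T} \<Longrightarrow> dist s x < d' \<Longrightarrow> dist (\<gamma> s) (\<gamma> x) < d"
        using cont local t d(1) unfolding continuous_on_iff by (metis atLeastAtMost_iff order_trans)
      show ?case
      proof (intro exI[of _ d'] conjI allI impI d')
        fix a b assume ab: "a \<le> x \<and> x \<le> b \<and> b - a < d'"
        show "P a b" unfolding P_def
        proof
          assume T: "0 \<le> a \<and> b \<le> T"
          have near: "norm (\<gamma> s - \<gamma> x) < d" if "s \<in> {a..b}" for s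
            using d'(2)[of s] that ab T by (simp add: dist_norm abs_if)
          have lin: "bounded_linear (\<phi>' (\<gamma> x))"
            using \<phi> has_derivative_bounded_linear by (auto simp: C1_deriv_def)
          have inc: "\<gamma> b - \<gamma> a = integral {a..b} v"
            using ab T by (intro is_primitive_increment[OF g]) auto
          have iv': "v integrable_on {a..b}" "(\<lambda>s. norm (v s)) integrable_on {a..b}"
            using iv[of a b] T by (auto simp: absolutely_integrable_on_def)
          have iw': "w integrable_on {a..b}"
            using iw[of a b] T by (auto simp: absolutely_integrable_on_def)
          have "norm (\<phi> (\<gamma> b) - \<phi> (\<gamma> a) - \<phi>' (\<gamma> x) (\<gamma> b - \<gamma> a)) \<le> e / 2 * norm (\<gamma> b - \<gamma> a)"
            using C1_deriv_linearization[OF \<phi>, of "e / 2" d "\<gamma> x" "\<gamma> b - \<gamma> x" "\<gamma> a - \<gamma> x"] e d near ab by simp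
          also have "\<dots> \<le> e / 2 * integral {a..b} (\<lambda>s. norm (v s))"
            unfolding inc using e iv' by (intro mult_left_mono integral_norm_bound_integral) auto
          finally have 1: "norm (\<phi> (\<gamma> b) - \<phi> (\<gamma> a) - \<phi>' (\<gamma> x) (\<gamma> b - \<gamma> a)) \<le> e / 2 * integral {a..b} (\<lambda>s. norm (v s))" .
          have eq: "\<phi>' (\<gamma> x) (\<gamma> b - \<gamma> a) - integral {a..b} w = integral {a..b} (\<lambda>s. \<phi>' (\<gamma> x) (v s) - w s)"
            using integral_linear[OF iv'(1) lin] integrable_linear[OF iv'(1) lin] iw'
            by (simp add: inc o_def Henstock_Kurzweil_Integration.integral_diff)
          have "norm (integral {a..b} (\<lambda>s. \<phi>' (\<gamma> x) (v s) - w s)) \<le> integral {a..b} (\<lambda>s. e / 2 * norm (v s))"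
          proof (rule integral_norm_bound_integral)
            show "(\<lambda>s. \<phi>' (\<gamma> x) (v s) - w s) integrable_on {a..b}"
              using integrable_linear[OF iv'(1) lin] iw' by (auto simp: o_def intro: integrable_diff)
            show "(\<lambda>s. e / 2 * norm (v s)) integrable_on {a..b}"
              by (intro integrable_on_mult_right iv')
            show "norm (\<phi>' (\<gamma> x) (v s) - w s) \<le> e / 2 * norm (v s)" if "s \<in> {a..b}" for s
              using d(2)[OF near[OF that], of "v s"] by (simp add: w_def norm_minus_commute)
          qed
          then have 2: "norm (\<phi>' (\<gamma> x) (\<gamma> b - \<gamma> a) - integral {a..b} w) \<le> e / 2 * integral {a..b} (\<lambda>s. norm (v s))"
            by (simp add: eq)
          show "norm (\<phi> (\<gamma> b) - \<phi> (\<gamma> a) - integral {a..b} w) \<le> e * integral {a..b} (\<lambda>s. norm (v s))"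
            using norm_triangle_le[OF add_mono[OF 1 2]] by (simp add: algebra_simps)
        qed
      qed
    qed
    then show ?thesis using t by (simp add: P_def)
  qed
  have "\<phi> (\<gamma> t) = \<phi> (\<gamma> 0) + integral {0..t} w" if t: "t \<in> {0..T}" for t
  proof -
    \<comment> \<open>The \<open>+ 1\<close> permits the division by \<open>I\<close> when the
      integral is zero.\<close>
    define I where "I = integral {0..t} (\<lambda>s. norm (v s)) + 1"
    have "0 \<le> integral {0..t} (\<lambda>s. norm (v s))"
      using iv[of 0 t] t
      by (intro Henstock_Kurzweil_Integration.integral_nonneg) (auto simp: absolutely_integrable_on_def)
    then have I: "I > 0" by (simp add: I_def)
    have "norm (\<phi> (\<gamma> t) - \<phi> (\<gamma> 0) - integral {0..t} w) \<le> 0 + e" if "e > 0" for e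
    proof -
      have "norm (\<phi> (\<gamma> t) - \<phi> (\<gamma> 0) - integral {0..t} w) \<le> e / I * integral {0..t} (\<lambda>s. norm (v s))"
        using est[OF t, of "e / I"] that I by simp
      also have "\<dots> \<le> e / I * I"
        using that I by (intro mult_left_mono) (auto simp: I_def)
      finally show ?thesis using I by simp
    qed
    then have "norm (\<phi> (\<gamma> t) - \<phi> (\<gamma> 0) - integral {0..t} w) \<le> 0" by (rule field_le_epsilon)
    then show ?thesis by (simp add: algebra_simps)
  qed
  with w show ?thesis
    unfolding is_primitive_def w_def[abs_def] by blast
qed

section \<open>Weak derivatives\<close>

lemma is_primitive_integrable:
  assumes "is_primitive T f v"
  shows "v absolutely_integrable_on {0..T}" "t \<le> T \<Longrightarrow> v integrable_on {0..t}"
proof -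
  show *: "v absolutely_integrable_on {0..T}"
    using assms by (simp add: is_primitive_def square_integrable_imp_absolutely_integrable)
  show "v integrable_on {0..t}" if "t \<le> T"
    by (rule integrable_subinterval_real[OF set_lebesgue_integral_eq_integral(1)[OF *]]) (use that in auto)
qed

lemma is_primitive_add:
  assumes f: "is_primitive T f v" and g: "is_primitive T g w"
  shows "is_primitive T (\<lambda>t. f t + g t) (\<lambda>t. v t + w t)"
  unfolding is_primitive_def
proof (intro conjI ballI)
  have sq: "square_integrable T v" "square_integrable T w"
    using f g by (auto simp: is_primitive_def)
  show "square_integrable T (\<lambda>t. v t + w t)"
    using sq by (intro square_integrable_dominated(1)[OF _ sq, of _ 1 1])
      (auto simp: square_integrable_def norm_triangle_ineq)
  fix t assume t: "t \<in> {0..T}"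
  have "integral {0..t} (\<lambda>t. v t + w t) = integral {0..t} v + integral {0..t} w"
    using is_primitive_integrable(2)[OF f] is_primitive_integrable(2)[OF g] t
    by (intro Henstock_Kurzweil_Integration.integral_add) auto
  moreover have "f t = f 0 + integral {0..t} v" "g t = g 0 + integral {0..t} w"
    using f g t unfolding is_primitive_def by blast+
  ultimately show "f t + g t = f 0 + g 0 + integral {0..t} (\<lambda>t. v t + w t)"
    by (simp only: ac_simps)
qed

lemma C1_deriv_bounded_linear: "bounded_linear L \<Longrightarrow> C1_deriv L (\<lambda>x. L)"
  by (simp add: C1_deriv_def bounded_linear_imp_has_derivative)

lemma is_primitive_bounded_linear:
  assumes "bounded_linear L" "is_primitive T f v"
  shows "is_primitive T (\<lambda>t. L (f t)) (\<lambda>t. L (v t))"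
  by (rule is_primitive_chain_rule[OF C1_deriv_bounded_linear]) (rule assms)+

lemma is_primitive_Pair:
  assumes "is_primitive T f v" "is_primitive T g w"
  shows "is_primitive T (\<lambda>t. (f t, g t)) (\<lambda>t. (v t, w t))"
proof -
  have "is_primitive T (\<lambda>t. (f t, 0) + (0, g t)) (\<lambda>t. (v t, 0) + (0, w t))"
    by (intro is_primitive_add is_primitive_bounded_linear[of "\<lambda>x. (x, 0)"]
        is_primitive_bounded_linear[of "\<lambda>x. (0, x)"] assms bounded_linear_Pair bounded_linear_ident bounded_linear_zero)
  then show ?thesis by simp
qed

text \<open>The chain rule for the multiplication map on the product space, applied to the curve
  \<open>(f t, g t)\<close>.\<close>

lemma is_primitive_scaleR:
  fixes g :: "real \<Rightarrow> 'a::euclidean_space"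
  assumes "is_primitive T f v" "is_primitive T g w"
  shows "is_primitive T (\<lambda>t. f t *\<^sub>R g t) (\<lambda>t. f t *\<^sub>R w t + v t *\<^sub>R g t)"
proof -
  have "C1_deriv (\<lambda>x. fst x *\<^sub>R snd x :: 'a) (\<lambda>x h. fst x *\<^sub>R snd h + fst h *\<^sub>R snd x)"
    unfolding C1_deriv_def by (auto intro!: derivative_eq_intros continuous_intros)
  from is_primitive_chain_rule[OF this is_primitive_Pair[OF assms]] show ?thesis by simp
qed

lemma C1_differentiable_on_UNIV_deriv:
  fixes \<psi> :: "real \<Rightarrow> real"
  assumes "\<psi> C1_differentiable_on UNIV"
  shows "(\<psi> has_vector_derivative deriv \<psi> t) (at t)" "continuous_on UNIV (deriv \<psi>)"
proof -
  obtain D where D: "\<And>x. (\<psi> has_vector_derivative D x) (at x)" "continuous_on UNIV D"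
    using assms by (auto simp: C1_differentiable_on_def)
  then have "deriv \<psi> = D"
    by (intro ext DERIV_imp_deriv) (simp add: has_real_derivative_iff_has_vector_derivative)
  with D show "(\<psi> has_vector_derivative deriv \<psi> t) (at t)" "continuous_on UNIV (deriv \<psi>)"
    by auto
qed

lemma is_primitive_C1:
  fixes \<psi> :: "real \<Rightarrow> real"
  assumes "\<psi> C1_differentiable_on UNIV"
  shows "is_primitive T \<psi> (deriv \<psi>)"
  unfolding is_primitive_def
proof (intro conjI ballI)
  note D = C1_differentiable_on_UNIV_deriv[OF assms]
  show "square_integrable T (deriv \<psi>)"
    by (intro square_integrable_continuous continuous_on_subset[OF D(2)]) auto
  fix t assume "t \<in> {0..T}"
  then have "(deriv \<psi> has_integral (\<psi> t - \<psi> 0)) {0..t}"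
    by (intro fundamental_theorem_of_calculus) (auto intro: has_vector_derivative_at_within D(1))
  then show "\<psi> t = \<psi> 0 + integral {0..t} (deriv \<psi>)"
    by (simp add: integral_unique)
qed

lemma test_function_zero:
  assumes "test_function T \<psi>" "t \<notin> {0<..<T}"
  shows "\<psi> t = 0"
proof (rule ccontr)
  assume "\<psi> t \<noteq> 0"
  then have "t \<in> closure {t. \<psi> t \<noteq> 0}" by (intro subsetD[OF closure_subset]) simp
  moreover have "closure {t. \<psi> t \<noteq> 0} \<subseteq> {0<..<T}"
    using assms(1) unfolding test_function_def by (rule conjunct2)
  ultimately show False using assms(2) by (meson subsetD)
qed

lemma test_function_products_integrable:
  fixes f v :: "real \<Rightarrow> 'a::euclidean_space"
  assumes "test_function T \<psi>" and f: "continuous_on {0..T} f" and v: "square_integrable T v"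
  shows "(\<lambda>t. deriv \<psi> t *\<^sub>R f t) absolutely_integrable_on {0..T}"
    "(\<lambda>t. \<psi> t *\<^sub>R v t) absolutely_integrable_on {0..T}"
proof -
  have \<psi>: "\<psi> C1_differentiable_on UNIV" using assms by (simp add: test_function_def)
  show "(\<lambda>t. deriv \<psi> t *\<^sub>R f t) absolutely_integrable_on {0..T}"
    by (intro absolutely_integrable_continuous_Icc continuous_intros f
        continuous_on_subset[OF C1_differentiable_on_UNIV_deriv(2)[OF \<psi>]]) auto
  have c: "continuous_on {0..T} \<psi>"
    using is_primitive_C1[OF \<psi>] by (rule is_primitive_continuous_on)
  show "(\<lambda>t. \<psi> t *\<^sub>R v t) absolutely_integrable_on {0..T}"
  proof (rule absolutely_integrable_bounded_measurable_product[where h = "(*\<^sub>R)"])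
    show "bilinear ((*\<^sub>R) :: real \<Rightarrow> 'a \<Rightarrow> 'a)"
      by (simp add: bilinear_conv_bounded_bilinear bounded_bilinear_scaleR)
    show "\<psi> \<in> borel_measurable (lebesgue_on {0..T})"
      by (intro continuous_imp_measurable_on_sets_lebesgue c) auto
    show "bounded (\<psi> ` {0..T})"
      using c by (intro compact_imp_bounded compact_continuous_image) auto
  qed (use square_integrable_imp_absolutely_integrable[OF v] in auto)
qed

lemma has_weak_derivative_iff_integral:
  assumes f: "continuous_on {0..T} f" and v: "square_integrable T v"
  shows "has_weak_derivative T f v \<longleftrightarrow> (\<forall>\<psi>. test_function T \<psi> \<longrightarrow>
    integral {0..T} (\<lambda>t. deriv \<psi> t *\<^sub>R f t) = - integral {0..T} (\<lambda>t. \<psi> t *\<^sub>R v t))"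
  unfolding has_weak_derivative_def
  using test_function_products_integrable[OF _ f v] by (auto simp: lebesgue_on_Ioo_eq_integral)

text \<open>Integrating the product rule for \<open>\<psi> t *\<^sub>R f t\<close> over
  \<open>{0..T}\<close> gives the claim: the boundary terms vanish because a test function is zero
  at both end points.\<close>

lemma is_primitive_imp_has_weak_derivative:
  assumes "is_primitive T f v" "T > 0"
  shows "has_weak_derivative T f v"
proof -
  have cont: "continuous_on {0..T} f" by (rule is_primitive_continuous_on[OF assms(1)])
  have sq: "square_integrable T v" using assms by (simp add: is_primitive_def)
  have "integral {0..T} (\<lambda>t. deriv \<psi> t *\<^sub>R f t) = - integral {0..T} (\<lambda>t. \<psi> t *\<^sub>R v t)"
    if \<psi>: "test_function T \<psi>" for \<psi>
  proof -
    have "is_primitive T \<psi> (deriv \<psi>)"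
      using \<psi> by (intro is_primitive_C1) (simp add: test_function_def)
    from is_primitive_scaleR[OF this assms(1)]
    have "\<psi> T *\<^sub>R f T = \<psi> 0 *\<^sub>R f 0 + integral {0..T} (\<lambda>t. \<psi> t *\<^sub>R v t + deriv \<psi> t *\<^sub>R f t)"
      using \<open>T > 0\<close> unfolding is_primitive_def by (meson atLeastAtMost_iff order_refl less_imp_le)
    then have "0 = integral {0..T} (\<lambda>t. \<psi> t *\<^sub>R v t + deriv \<psi> t *\<^sub>R f t)"
      by (simp add: test_function_zero[OF \<psi>])
    also have "\<dots> = integral {0..T} (\<lambda>t. \<psi> t *\<^sub>R v t) + integral {0..T} (\<lambda>t. deriv \<psi> t *\<^sub>R f t)"
      using test_function_products_integrable[OF \<psi> cont sq]
      by (intro Henstock_Kurzweil_Integration.integral_add) (auto simp: absolutely_integrable_on_def)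
    finally show ?thesis by (simp add: eq_neg_iff_add_eq_0 add.commute)
  qed
  then show ?thesis using has_weak_derivative_iff_integral[OF cont sq] by blast
qed

section \<open>Hat functions and the du Bois-Reymond lemma\<close>

definition tent :: "real \<Rightarrow> real \<Rightarrow> real" where
  "tent r x = max 0 (x + r) - 2 * max 0 x + max 0 (x - r)"

text \<open>Twice a primitive of \<open>tent r\<close>, which is the hat of height \<open>r\<close>
  on \<open>{-r..r}\<close> with integral \<open>r\<^sup>2\<close>. Being a second difference of the
  squared positive part, it is explicit and continuously differentiable, with a plateau on either
  side of the hat.\<close>

definition tent_primitive :: "real \<Rightarrow> real \<Rightarrow> real" where
  "tent_primitive r x = (max 0 (x + r))\<^sup>2 - 2 * (max 0 x)\<^sup>2 + (max 0 (x - r))\<^sup>2"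

text \<open>Squaring removes the kink of the positive part: at 0 the difference quotient is bounded
  by \<open>\<bar>h\<bar>\<close>. This is what makes \<open>tent_primitive\<close> smooth enough
  for test functions.\<close>

lemma has_real_derivative_max_0_power2:
  "((\<lambda>x::real. (max 0 x)\<^sup>2) has_real_derivative 2 * max 0 x) (at x)"
proof (cases "x = 0")
  case True
  have "((\<lambda>h::real. (max 0 h)\<^sup>2 / h) \<longlongrightarrow> 0) (at 0)"
  proof (rule Lim_null_comparison[where g = "\<lambda>h. \<bar>h\<bar>"])
    show "\<forall>\<^sub>F h in at 0. norm ((max 0 h)\<^sup>2 / h) \<le> \<bar>h\<bar>"
      by (intro always_eventually) (auto simp: max_def power2_eq_square)
    show "((\<lambda>h::real. \<bar>h\<bar>) \<longlongrightarrow> 0) (at 0)"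
      by (rule tendsto_rabs_zero) simp
  qed
  with True show ?thesis by (simp add: DERIV_def)
next
  case False
  then consider "x > 0" | "x < 0" by linarith
  then show ?thesis
  proof cases
    case 1
    have "((\<lambda>x. x\<^sup>2) has_real_derivative 2 * max 0 x) (at x)"
      using 1 by (auto intro!: derivative_eq_intros)
    then show ?thesis
      by (rule has_field_derivative_transform_within_open[of _ _ _ "{0<..}"]) (use 1 in auto)
  next
    case 2
    have "((\<lambda>x. 0) has_real_derivative 2 * max 0 x) (at x)"
      using 2 by (auto intro!: derivative_eq_intros)
    then show ?thesis
      by (rule has_field_derivative_transform_within_open[of _ _ _ "{..<0}"]) (use 2 in auto)
  qed
qed

lemma has_real_derivative_tent_primitive:
  "((\<lambda>x. tent_primitive r (x - c)) has_real_derivative 2 * tent r (x - c)) (at x)"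
proof -
  have "((\<lambda>x::real. (max 0 (x - c + a))\<^sup>2) has_real_derivative 2 * max 0 (x - c + a)) (at x)" for a
  proof -
    have "((\<lambda>x. x - c + a) has_real_derivative 1) (at x)"
      by (auto intro!: derivative_eq_intros)
    from DERIV_chain2[OF has_real_derivative_max_0_power2 this] show ?thesis by simp
  qed
  from DERIV_add[OF DERIV_diff[OF this[of r] DERIV_cmult[OF this[of 0], of 2]] this[of "- r"]] show ?thesis
    unfolding tent_primitive_def tent_def by (simp add: algebra_simps)
qed

lemma continuous_on_tent: "continuous_on S (\<lambda>x. tent r (x - c))"
  unfolding tent_def by (intro continuous_intros)

lemma tent_nonneg: "0 \<le> r \<Longrightarrow> 0 \<le> tent r x"
  and tent_eq_0: "r \<le> \<bar>x\<bar> \<Longrightarrow> 0 \<le> r \<Longrightarrow> tent r x = 0"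
  by (auto simp: tent_def max_def)

lemma tent_primitive_eq_0: "x \<le> - r \<Longrightarrow> 0 \<le> r \<Longrightarrow> tent_primitive r x = 0"
  and tent_primitive_eq_const: "r \<le> x \<Longrightarrow> 0 \<le> r \<Longrightarrow> tent_primitive r x = 2 * r\<^sup>2"
  by (auto simp: tent_primitive_def max_def power2_eq_square algebra_simps)

lemma integral_tent:
  assumes "0 \<le> r" "0 \<le> c - r" "c + r \<le> T"
  shows "integral {0..T} (\<lambda>x. tent r (x - c)) = r\<^sup>2"
proof -
  have "((\<lambda>x. 2 * tent r (x - c)) has_integral (tent_primitive r (T - c) - tent_primitive r (0 - c))) {0..T}"
    using assms has_real_derivative_tent_primitive
    by (intro fundamental_theorem_of_calculus)
      (auto simp: has_real_derivative_iff_has_vector_derivative intro: has_vector_derivative_at_within)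
  then have "integral {0..T} (\<lambda>x. 2 * tent r (x - c)) = tent_primitive r (T - c) - tent_primitive r (0 - c)"
    by (rule integral_unique)
  also have "\<dots> = 2 * r\<^sup>2"
    using assms by (simp add: tent_primitive_eq_0 tent_primitive_eq_const)
  finally show ?thesis by simp
qed

text \<open>The translated hat is nonnegative with total mass \<open>r\<^sup>2\<close>, so the
  integral is \<open>r\<^sup>2\<close> times a weighted mean of \<open>w\<close> over points closer
  to \<open>c\<close> than \<open>r\<close>.\<close>

lemma integral_tent_approx:
  fixes w :: "real \<Rightarrow> 'a::euclidean_space"
  assumes w: "continuous_on {0..T} w" and r: "0 \<le> r" "0 \<le> c - r" "c + r \<le> T"
    and e: "\<And>x. x \<in> {0..T} \<Longrightarrow> \<bar>x - c\<bar> < r \<Longrightarrow> norm (w x - w c) \<le> e"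
  shows "norm (integral {0..T} (\<lambda>x. tent r (x - c) *\<^sub>R w x) - r\<^sup>2 *\<^sub>R w c) \<le> e * r\<^sup>2"
proof -
  have "integral {0..T} (\<lambda>x. tent r (x - c) *\<^sub>R w x) - r\<^sup>2 *\<^sub>R w c
      = integral {0..T} (\<lambda>x. tent r (x - c) *\<^sub>R w x) - integral {0..T} (\<lambda>x. tent r (x - c) *\<^sub>R w c)"
    using integral_linear[of "\<lambda>x. tent r (x - c)" "{0..T}" "\<lambda>y. y *\<^sub>R w c"] integral_tent[OF r]
    by (simp add: o_def bounded_linear_scaleR_left integrable_continuous_real continuous_on_tent)
  also have "\<dots> = integral {0..T} (\<lambda>x. tent r (x - c) *\<^sub>R w x - tent r (x - c) *\<^sub>R w c)"
    by (intro Henstock_Kurzweil_Integration.integral_diff[symmetric] integrable_continuous_real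
        continuous_intros continuous_on_tent w)
  also have "norm \<dots> \<le> integral {0..T} (\<lambda>x. e * tent r (x - c))"
  proof (rule integral_norm_bound_integral)
    show "norm (tent r (x - c) *\<^sub>R w x - tent r (x - c) *\<^sub>R w c) \<le> e * tent r (x - c)" if "x \<in> {0..T}" for x
    proof (cases "\<bar>x - c\<bar> < r")
      case True
      have "norm (tent r (x - c) *\<^sub>R w x - tent r (x - c) *\<^sub>R w c) = norm (w x - w c) * tent r (x - c)"
        using tent_nonneg[OF r(1), of "x - c"] by (simp flip: scaleR_diff_right)
      also have "\<dots> \<le> e * tent r (x - c)"
        by (intro mult_right_mono e that True tent_nonneg r)
      finally show ?thesis .
    next
      case False
      then show ?thesis using r by (simp add: tent_eq_0)
    qed
  qed (intro integrable_continuous_real continuous_intros continuous_on_tent w)+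
  also have "\<dots> = e * r\<^sup>2"
    by (simp add: integral_tent[OF r])
  finally show ?thesis .
qed

text \<open>The du Bois-Reymond lemma: testing with differences of translated tent primitives compares the
  mean values of \<open>w\<close> near two points.\<close>

lemma weak_derivative_zero_imp_constant:
  fixes w :: "real \<Rightarrow> 'a::euclidean_space"
  assumes w: "continuous_on {0..T} w"
    and zero: "\<And>\<psi>. test_function T \<psi> \<Longrightarrow> integral {0..T} (\<lambda>t. deriv \<psi> t *\<^sub>R w t) = 0"
    and pq: "0 < p" "p < q" "q < T"
  shows "w p = w q"
proof -
  have "norm (w p - w q) \<le> 0 + e" if "e > 0" for e
  proof -
    have e: "e / 2 > 0" using that by simp
    have pqT: "p \<in> {0..T}" "q \<in> {0..T}" using pq by auto
    obtain d1 where d1: "d1 > 0" "\<And>x. x \<in> {0..T} \<Longrightarrow> dist x p < d1 \<Longrightarrow> dist (w x) (w p) < e / 2"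
      using w[unfolded continuous_on_iff, rule_format, OF pqT(1) e] by blast
    obtain d2 where d2: "d2 > 0" "\<And>x. x \<in> {0..T} \<Longrightarrow> dist x q < d2 \<Longrightarrow> dist (w x) (w q) < e / 2"
      using w[unfolded continuous_on_iff, rule_format, OF pqT(2) e] by blast
    \<comment> \<open>Below \<open>d1\<close> and \<open>d2\<close> the values of \<open>w\<close>
      are within \<open>e / 2\<close> of \<open>w p\<close> and \<open>w q\<close>. The halving
      makes \<open>r < p\<close> and \<open>r < T - q\<close> strict, so that
      \<open>{p - r..q + r}\<close> is a closed subset of the open interval.\<close>
    define r where "r = min (min d1 d2) (min p (T - q)) / 2"
    have r: "0 < r" "r \<le> d1" "r \<le> d2" "r < p" "r < T - q"
      using d1(1) d2(1) pq by (auto simp: r_def min_def)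
    \<comment> \<open>Beyond \<open>q + r\<close> both terms have reached the plateau
      \<open>2 * r\<^sup>2\<close> and cancel, so \<open>\<psi>\<close> has compact support although
      neither term has.\<close>
    define \<psi> where "\<psi> x = tent_primitive r (x - p) - tent_primitive r (x - q)" for x
    have der: "(\<psi> has_real_derivative 2 * tent r (x - p) - 2 * tent r (x - q)) (at x)" for x
      unfolding \<psi>_def by (intro DERIV_diff has_real_derivative_tent_primitive)
    have "test_function T \<psi>"
      unfolding test_function_def
    proof
      show "\<psi> C1_differentiable_on UNIV"
        unfolding C1_differentiable_on_def
        using der by (intro exI[of _ "\<lambda>x. 2 * tent r (x - p) - 2 * tent r (x - q)"] conjI ballI)
          (auto simp: has_real_derivative_iff_has_vector_derivative intro!: continuous_intros continuous_on_tent)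
      have "\<psi> x = 0" if "x \<notin> {p - r..q + r}" for x
      proof (cases "x < p - r")
        case True
        then show ?thesis using r pq by (simp add: \<psi>_def tent_primitive_eq_0)
      next
        case False
        then have "q + r < x" using that by auto
        then show ?thesis using r pq by (simp add: \<psi>_def tent_primitive_eq_const)
      qed
      then have "{x. \<psi> x \<noteq> 0} \<subseteq> {p - r..q + r}"
        by blast
      then have "closure {x. \<psi> x \<noteq> 0} \<subseteq> {p - r..q + r}"
        by (rule closure_minimal) simp
      also have "\<dots> \<subseteq> {0<..<T}" using r by auto
      finally show "closure {x. \<psi> x \<noteq> 0} \<subseteq> {0<..<T}" .
    qed
    from zero[OF this] have "integral {0..T} (\<lambda>x. (2 * tent r (x - p) - 2 * tent r (x - q)) *\<^sub>R w x) = 0"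
      by (simp add: DERIV_imp_deriv[OF der])
    also have "(\<lambda>x. (2 * tent r (x - p) - 2 * tent r (x - q)) *\<^sub>R w x)
        = (\<lambda>x. 2 *\<^sub>R (tent r (x - p) *\<^sub>R w x - tent r (x - q) *\<^sub>R w x))"
      by (simp add: algebra_simps)
    also have "integral {0..T} \<dots> = 2 *\<^sub>R (integral {0..T} (\<lambda>x. tent r (x - p) *\<^sub>R w x)
        - integral {0..T} (\<lambda>x. tent r (x - q) *\<^sub>R w x))"
      by (subst integral_cmul, subst Henstock_Kurzweil_Integration.integral_diff)
        (auto intro!: integrable_continuous_real continuous_intros continuous_on_tent w)
    finally have eq: "integral {0..T} (\<lambda>x. tent r (x - p) *\<^sub>R w x) = integral {0..T} (\<lambda>x. tent r (x - q) *\<^sub>R w x)"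
      by simp
    have "norm (integral {0..T} (\<lambda>x. tent r (x - p) *\<^sub>R w x) - r\<^sup>2 *\<^sub>R w p) \<le> e / 2 * r\<^sup>2"
      using d1(2) r pq by (intro integral_tent_approx w) (auto simp: dist_norm intro!: less_imp_le)
    moreover have "norm (integral {0..T} (\<lambda>x. tent r (x - q) *\<^sub>R w x) - r\<^sup>2 *\<^sub>R w q) \<le> e / 2 * r\<^sup>2"
      using d2(2) r pq by (intro integral_tent_approx w) (auto simp: dist_norm intro!: less_imp_le)
    ultimately have "norm ((integral {0..T} (\<lambda>x. tent r (x - q) *\<^sub>R w x) - r\<^sup>2 *\<^sub>R w q)
        - (integral {0..T} (\<lambda>x. tent r (x - p) *\<^sub>R w x) - r\<^sup>2 *\<^sub>R w p)) \<le> e / 2 * r\<^sup>2 + e / 2 * r\<^sup>2"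
      by (intro order_trans[OF norm_triangle_ineq4]) linarith
    then have "norm (r\<^sup>2 *\<^sub>R (w p - w q)) \<le> e * r\<^sup>2"
      by (simp add: eq scaleR_diff_right)
    then show ?thesis using r by simp
  qed
  then have "norm (w p - w q) \<le> 0" by (rule field_le_epsilon)
  then show ?thesis by simp
qed

text \<open>The primitive \<open>u\<close> of \<open>v\<close> has the same weak derivative as
  \<open>f\<close>, so \<open>f - u\<close> is constant on the open interval by the du Bois-Reymond
  lemma, and continuity carries the constant to the end points.\<close>

lemma has_weak_derivative_imp_is_primitive:
  fixes f v :: "real \<Rightarrow> 'a::euclidean_space"
  assumes f: "continuous_on {0..T} f" and v: "square_integrable T v"
    and weak: "has_weak_derivative T f v" and "T > 0"
  shows "is_primitive T f v"
proof -
  define u where "u t = integral {0..t} v" for t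
  have u: "is_primitive T u v"
    using v by (simp add: is_primitive_def u_def)
  define w where "w t = f t - u t" for t
  have cu: "continuous_on {0..T} u" by (rule is_primitive_continuous_on[OF u])
  then have cw: "continuous_on {0..T} w"
    unfolding w_def by (intro continuous_intros f)
  have "integral {0..T} (\<lambda>t. deriv \<psi> t *\<^sub>R w t) = 0" if \<psi>: "test_function T \<psi>" for \<psi>
  proof -
    have "integral {0..T} (\<lambda>t. deriv \<psi> t *\<^sub>R w t)
        = integral {0..T} (\<lambda>t. deriv \<psi> t *\<^sub>R f t) - integral {0..T} (\<lambda>t. deriv \<psi> t *\<^sub>R u t)"
      unfolding w_def scaleR_diff_right
      using test_function_products_integrable(1)[OF \<psi> f v] test_function_products_integrable(1)[OF \<psi> cu v]
      by (intro Henstock_Kurzweil_Integration.integral_diff) (auto simp: absolutely_integrable_on_def)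
    also have "\<dots> = 0"
      using is_primitive_imp_has_weak_derivative[OF u \<open>T > 0\<close>] weak \<psi>
        has_weak_derivative_iff_integral[OF f v] has_weak_derivative_iff_integral[OF cu v] by simp
    finally show ?thesis .
  qed
  then have eq: "w p = w q" if "p \<in> {0<..<T}" "q \<in> {0<..<T}" for p q
    using weak_derivative_zero_imp_constant[OF cw] that
    by (metis greaterThanLessThan_iff linorder_less_linear)
  have const: "w t = w (T / 2)" if "t \<in> {0..T}" for t
  proof (rule continuous_constant_on_closure[of "{0<..<T}" w])
    show "w x = w (T / 2)" if "x \<in> {0<..<T}" for x
      using that \<open>T > 0\<close> by (intro eq) auto
  qed (use that \<open>T > 0\<close> cw in simp_all)
  have "f t = f 0 + integral {0..t} v" if "t \<in> {0..T}" for t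
  proof -
    have "w t = w 0"
      using const[OF that] const[of 0] \<open>T > 0\<close> by simp
    then show ?thesis by (simp add: w_def u_def algebra_simps)
  qed
  with v show ?thesis unfolding is_primitive_def by blast
qed

text \<open>The difference \<open>v - w\<close> has integral zero over every subinterval, hence
  vanishes wherever its averages over \<open>{x..x + h}\<close> converge to its value, that is,
  almost everywhere. The norm of H1 thereby becomes independent of the version selected by
  \<open>weak_derivative\<close>.\<close>

lemma is_primitive_unique_AE:
  fixes f v w :: "real \<Rightarrow> 'a::euclidean_space"
  assumes v: "is_primitive T f v" and w: "is_primitive T f w"
  shows "AE t in lebesgue_on {0<..<T}. v t = w t"
proof -
  \<comment> \<open>The extension by zero is integrable on every box, as the differentiation theorem
    for averages demands.\<close>
  define u where "u t = (if t \<in> {0..T} then v t - w t else 0)" for t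
  have vw: "(\<lambda>t. v t - w t) absolutely_integrable_on {0..T}"
    using is_primitive_integrable(1)[OF v] is_primitive_integrable(1)[OF w] by (rule set_integral_diff(1))
  then have "u absolutely_integrable_on UNIV"
    unfolding u_def[abs_def] by (subst absolutely_integrable_restrict_UNIV)
  then have "u integrable_on cbox a b" for a b
    by (meson absolutely_integrable_on_subcbox set_lebesgue_integral_eq_integral(1) subset_UNIV)
  then obtain N where N: "negligible N" and lim:
    "\<And>x e. \<lbrakk>x \<notin> N; 0 < e\<rbrakk> \<Longrightarrow> \<exists>d>0. \<forall>h. 0 < h \<and> h < d \<longrightarrow>
       norm (integral (cbox x (x + h *\<^sub>R One)) u /\<^sub>R h ^ DIM(real) - u x) < e"
    using integrable_ccontinuous_explicit[of u] by metis
  have "u x = 0" if x: "x \<in> {0<..<T}" "x \<notin> N" for x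
  proof (rule ccontr)
    assume "u x \<noteq> 0"
    then obtain d where d: "d > 0" "\<And>h. 0 < h \<Longrightarrow> h < d \<Longrightarrow>
        norm (integral (cbox x (x + h *\<^sub>R One)) u /\<^sub>R h ^ DIM(real) - u x) < norm (u x)"
      using lim[OF x(2), of "norm (u x)"] by auto
    define h where "h = min d (T - x) / 2"
    have h: "0 < h" "h < d" "x + h \<le> T" using d(1) x by (auto simp: h_def min_def field_simps)
    have "integral {x..x + h} u = integral {x..x + h} (\<lambda>t. v t - w t)"
      using x h by (intro Henstock_Kurzweil_Integration.integral_cong) (auto simp: u_def)
    also have "\<dots> = integral {x..x + h} v - integral {x..x + h} w"
      using x h is_primitive_integrable(2)[OF v, of T] is_primitive_integrable(2)[OF w, of T]
      by (intro Henstock_Kurzweil_Integration.integral_diff) (auto elim!: integrable_subinterval_real)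
    also have "\<dots> = 0"
      using is_primitive_increment[OF v, of x "x + h"] is_primitive_increment[OF w, of x "x + h"] x h by simp
    finally show False using d(2)[OF h(1,2)] by simp
  qed
  then have eq: "v x = w x" if "x \<in> {0<..<T}" "x \<notin> N" for x
    using that by (auto simp: u_def split: if_splits)
  have "AE x in lebesgue. x \<notin> N"
    using N by (intro AE_not_in) (simp add: negligible_iff_null_sets)
  then have "AE x in lebesgue. x \<in> {0<..<T} \<longrightarrow> v x = w x"
    by eventually_elim (use eq in auto)
  then show ?thesis by (subst AE_restrict_space_iff) auto
qed

section \<open>The space \<open>H\<^sup>1\<close>\<close>

lemma is_primitive_cong:
  assumes "\<And>t. t \<in> {0..T} \<Longrightarrow> f t = g t" "0 \<le> T"
  shows "is_primitive T f v \<longleftrightarrow> is_primitive T g v"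
proof -
  have "f 0 = g 0" using assms by simp
  with assms(1) show ?thesis by (auto simp: is_primitive_def)
qed

lemma is_primitive_square_integrable:
  assumes "is_primitive T f v"
  shows "square_integrable T v" "square_integrable T f"
  using assms is_primitive_continuous_on[OF assms]
  by (simp_all only: is_primitive_def square_integrable_continuous)

lemma is_primitive_zero: "is_primitive T (\<lambda>t. 0) (\<lambda>t. 0)"
  by (simp add: is_primitive_def square_integrable_continuous)

lemma is_primitive_diff:
  assumes "is_primitive T f v" "is_primitive T g w"
  shows "is_primitive T (\<lambda>t. f t - g t) (\<lambda>t. v t - w t)"
  using is_primitive_add[OF assms(1) is_primitive_bounded_linear[OF bounded_linear_minus[OF bounded_linear_ident] assms(2)]]
  by simp

lemma is_primitive_sum:
  assumes "\<And>i. i \<in> I \<Longrightarrow> is_primitive T (f i) (v i)"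
  shows "is_primitive T (\<lambda>t. \<Sum>i\<in>I. f i t) (\<lambda>t. \<Sum>i\<in>I. v i t)"
  using assms
  by (induction I rule: infinite_finite_induct) (simp_all add: is_primitive_zero is_primitive_add)

text \<open>Weak derivatives and derivatives of primitives coincide for continuous functions, so
  membership becomes the existence of an explicit derivative, to which the chain and product rules
  apply.\<close>

lemma mem_carrier_H1_iff:
  assumes "T > 0"
  shows "f \<in> carrier (H1 T) \<longleftrightarrow> (\<forall>t. t \<notin> {0..T} \<longrightarrow> f t = 0) \<and> (\<exists>v. is_primitive T f v)"
proof -
  have "is_primitive T f v \<longleftrightarrow> continuous_on {0..T} f \<and> square_integrable T v \<and> has_weak_derivative T f v" for v
    using is_primitive_continuous_on is_primitive_imp_has_weak_derivative has_weak_derivative_imp_is_primitive assms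
    unfolding is_primitive_def by blast
  then show ?thesis
    unfolding H1_def by (auto intro: square_integrable_continuous)
qed

lemma carrier_H1_vanishes: "f \<in> carrier (H1 T) \<Longrightarrow> t \<notin> {0..T} \<Longrightarrow> f t = 0"
  by (simp add: H1_def)

lemma zero_ext_in_carrier_H1:
  assumes "is_primitive T f v" "T > 0"
  shows "zero_ext {0..T} f \<in> carrier (H1 T)" "is_primitive T (zero_ext {0..T} f) v"
proof -
  show *: "is_primitive T (zero_ext {0..T} f) v"
    using assms is_primitive_cong[of T "zero_ext {0..T} f" f v] by (simp add: zero_ext_def)
  show "zero_ext {0..T} f \<in> carrier (H1 T)"
    unfolding mem_carrier_H1_iff[OF assms(2)] using * by (auto simp: zero_ext_def)
qed

lemma is_primitive_weak_derivative:
  assumes f: "f \<in> carrier (H1 T)" and "T > 0"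
  shows "is_primitive T f (weak_derivative T f)"
proof -
  have "\<exists>v. square_integrable T v \<and> has_weak_derivative T f v"
    using f by (simp add: H1_def)
  then have "square_integrable T (weak_derivative T f) \<and> has_weak_derivative T f (weak_derivative T f)"
    unfolding weak_derivative_def by (rule someI_ex)
  then show ?thesis
    using f \<open>T > 0\<close> by (intro has_weak_derivative_imp_is_primitive) (auto simp: H1_def)
qed

text \<open>The selected weak derivative agrees with \<open>v\<close> almost everywhere, so any
  known derivative computes the norm.\<close>

lemma nrm_H1_eq:
  assumes f: "f \<in> carrier (H1 T)" and v: "is_primitive T f v" and "T > 0"
  shows "nrm (H1 T) f = sqrt ((L2_norm T f)\<^sup>2 + (L2_norm T v)\<^sup>2)"
proof -
  have w: "is_primitive T f (weak_derivative T f)"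
    using f \<open>T > 0\<close> by (rule is_primitive_weak_derivative)
  have "AE t in lebesgue_on {0<..<T}. (norm (weak_derivative T f t))\<^sup>2 = (norm (v t))\<^sup>2"
    using is_primitive_unique_AE[OF w v] by eventually_elim simp
  then have "(LINT t|lebesgue_on {0<..<T}. (norm (weak_derivative T f t))\<^sup>2)
      = (LINT t|lebesgue_on {0<..<T}. (norm (v t))\<^sup>2)"
    using is_primitive_square_integrable(1)[OF v] is_primitive_square_integrable(1)[OF w]
    by (intro integral_cong_AE) (auto simp: square_integrable_def)
  then show ?thesis by (simp add: H1_def L2_norm_power2)
qed

lemma nrm_H1_bounds:
  assumes "f \<in> carrier (H1 T)" "is_primitive T f v" "T > 0"
  shows "L2_norm T f \<le> nrm (H1 T) f" "L2_norm T v \<le> nrm (H1 T) f"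
    "nrm (H1 T) f \<le> L2_norm T f + L2_norm T v"
  unfolding nrm_H1_eq[OF assms]
  by (auto intro!: real_le_rsqrt sqrt_sum_squares_le_sum L2_norm_nonneg)

lemma nrm_H1_nonneg: "0 \<le> nrm (H1 T) f"
  by (simp add: H1_def)

lemma L2_norm_le_sup:
  assumes f: "continuous_on {0..T} f" and "0 \<le> A" "T > 0"
    and le: "\<And>t. t \<in> {0..T} \<Longrightarrow> norm (f t) \<le> A"
  shows "L2_norm T f \<le> sqrt T * A"
proof -
  have "(LINT t|lebesgue_on {0<..<T}. (norm (f t))\<^sup>2) \<le> (LINT t|lebesgue_on {0<..<T}. A\<^sup>2)"
    using square_integrable_continuous[OF f] le
    by (intro integral_mono) (auto simp: square_integrable_def intro!: power_mono)
  also have "\<dots> = T * A\<^sup>2"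
    using \<open>T > 0\<close> by (simp add: measure_restrict_space)
  finally have "L2_norm T f \<le> sqrt (T * A\<^sup>2)"
    unfolding L2_norm_def by (rule real_sqrt_le_mono)
  then show ?thesis using \<open>0 \<le> A\<close> by (simp add: real_sqrt_mult)
qed

text \<open>The common shape of the estimates for products and remainders: a sup bound for the
  values, integrated over an interval of length \<open>T\<close>, and an L2 bound for the
  derivative. Two reference functions occur because these derivatives split into a part containing
  one given weak derivative and a part containing another.\<close>

lemma nrm_H1_le:
  assumes r: "r \<in> carrier (H1 T)" "is_primitive T r w" and "T > 0"
    and p: "square_integrable T p" and q: "square_integrable T q"
    and nonneg: "0 \<le> A" "0 \<le> B" "0 \<le> C"
    and le: "\<And>t. t \<in> {0..T} \<Longrightarrow> norm (r t) \<le> A"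
      "\<And>t. t \<in> {0<..<T} \<Longrightarrow> norm (w t) \<le> B * norm (p t) + C * norm (q t)"
  shows "nrm (H1 T) r \<le> sqrt T * A + 2 * B * L2_norm T p + 2 * C * L2_norm T q"
proof -
  have "nrm (H1 T) r \<le> L2_norm T r + L2_norm T w"
    by (rule nrm_H1_bounds(3)[OF r \<open>T > 0\<close>])
  also have "L2_norm T r \<le> sqrt T * A"
    by (rule L2_norm_le_sup[OF is_primitive_continuous_on[OF r(2)]]) (use nonneg \<open>T > 0\<close> le in auto)
  also have "L2_norm T w \<le> 2 * B * L2_norm T p + 2 * C * L2_norm T q"
    using is_primitive_square_integrable(1)[OF r(2)]
    by (intro square_integrable_dominated(2)[OF _ p q] nonneg le) (auto simp: square_integrable_def)
  finally show ?thesis by simp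
qed

section \<open>Embedding of H1 into the bounded functions\<close>

definition H1_sup_const :: "real \<Rightarrow> real" where
  "H1_sup_const T = 1 / sqrt T + sqrt T"

lemma H1_sup_const_pos: "T > 0 \<Longrightarrow> H1_sup_const T > 0"
  by (auto simp: H1_sup_const_def intro: add_pos_pos)

text \<open>Two values of \<open>f\<close> differ by at most \<open>sqrt T * N\<close>, by
  integrating the derivative. Averaging over \<open>s\<close> then compares
  \<open>norm (f t)\<close> with the mean of \<open>norm (f s)\<close>, which is at most
  \<open>N / sqrt T\<close>. These two contributions are the summands of
  \<open>H1_sup_const\<close>.\<close>

lemma norm_le_nrm_H1:
  assumes f: "f \<in> carrier (H1 T)" and "T > 0"
  shows "norm (f t) \<le> H1_sup_const T * nrm (H1 T) f"
proof (cases "t \<in> {0..T}")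
  case False
  then show ?thesis
    using carrier_H1_vanishes[OF f] nrm_H1_nonneg[of T f] H1_sup_const_pos[OF \<open>T > 0\<close>] by simp
next
  case True
  define N where "N = nrm (H1 T) f"
  define v where "v = weak_derivative T f"
  have v: "is_primitive T f v"
    unfolding v_def using f \<open>T > 0\<close> by (rule is_primitive_weak_derivative)
  have cont: "continuous_on {0..T} f" by (rule is_primitive_continuous_on[OF v])
  note sq = is_primitive_square_integrable[OF v]
  have nv: "(\<lambda>s. norm (v s)) integrable_on {0..T}"
    using is_primitive_integrable(1)[OF v] by (simp add: absolutely_integrable_on_def)
  have V: "integral {0..T} (\<lambda>s. norm (v s)) \<le> sqrt T * N"
  proof -
    have "integral {0..T} (\<lambda>s. norm (v s)) \<le> sqrt T * L2_norm T v"
      by (rule integral_norm_le_L2_norm[OF sq(1) \<open>T > 0\<close>])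
    also have "\<dots> \<le> sqrt T * N"
      unfolding N_def using \<open>T > 0\<close> by (intro mult_left_mono nrm_H1_bounds(2)[OF f v]) auto
    finally show ?thesis .
  qed
  have inc: "norm (f b - f a) \<le> sqrt T * N" if "0 \<le> a" "a \<le> b" "b \<le> T" for a b
  proof -
    have "norm (f b - f a) \<le> integral {a..b} (\<lambda>s. norm (v s))"
      unfolding is_primitive_increment[OF v that]
      using that is_primitive_integrable(2)[OF v, of T] nv
      by (intro integral_norm_bound_integral) (auto elim!: integrable_subinterval_real)
    also have "\<dots> \<le> integral {0..T} (\<lambda>s. norm (v s))"
      using that nv by (intro integral_subset_le) (auto elim!: integrable_subinterval_real)
    finally show ?thesis using V by simp
  qed
  have lower: "norm (f t) - sqrt T * N \<le> norm (f s)" if "s \<in> {0..T}" for s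
  proof -
    have "norm (f t - f s) \<le> sqrt T * N"
      using inc[of s t] inc[of t s] True that by (cases "s \<le> t") (auto simp: norm_minus_commute)
    then show ?thesis using norm_triangle_ineq2[of "f t" "f s"] by linarith
  qed
  have "(norm (f t) - sqrt T * N) * T = integral {0..T} (\<lambda>s. norm (f t) - sqrt T * N)"
    using \<open>T > 0\<close> by simp
  also have "\<dots> \<le> integral {0..T} (\<lambda>s. norm (f s))"
    by (intro integral_le lower integrable_continuous_real continuous_intros cont)
  also have "\<dots> \<le> sqrt T * L2_norm T f"
    by (rule integral_norm_le_L2_norm[OF sq(2) \<open>T > 0\<close>])
  also have "\<dots> \<le> sqrt T * N"
    unfolding N_def using \<open>T > 0\<close> by (intro mult_left_mono nrm_H1_bounds(1)[OF f v]) auto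
  finally have "(norm (f t) - sqrt T * N) * T \<le> sqrt T * N" .
  \<comment> \<open>A factor \<open>sqrt T\<close> is cancelled, by
    \<open>T = sqrt T * sqrt T\<close>.\<close>
  then have "(norm (f t) - sqrt T * N) * sqrt T \<le> N"
    using \<open>T > 0\<close> by (smt (verit, ccfv_SIG) mult.assoc mult.commute mult_less_cancel_left_pos real_sqrt_gt_zero real_sqrt_mult_self abs_of_pos)
  then show ?thesis
    using \<open>T > 0\<close> unfolding H1_sup_const_def N_def[symmetric]
    by (simp add: field_simps)
qed

section \<open>Linear operations and products in H1\<close>

lemma carrier_H1_add:
  assumes "f \<in> carrier (H1 T)" "g \<in> carrier (H1 T)" "T > 0"
  shows "f + g \<in> carrier (H1 T)"
  using assms is_primitive_add unfolding mem_carrier_H1_iff[OF assms(3)] plus_fun_def by fastforce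

lemma carrier_H1_diff:
  assumes "f \<in> carrier (H1 T)" "g \<in> carrier (H1 T)" "T > 0"
  shows "f - g \<in> carrier (H1 T)"
  using assms is_primitive_diff unfolding mem_carrier_H1_iff[OF assms(3)] fun_diff_def by fastforce

lemma carrier_H1_scaleR:
  assumes "f \<in> carrier (H1 T)" "T > 0"
  shows "c *\<^sub>R f \<in> carrier (H1 T)"
  using assms is_primitive_bounded_linear[OF bounded_linear_scaleR_right]
  unfolding mem_carrier_H1_iff[OF assms(2)] scaleR_fun_def by fastforce

lemma carrier_H1_0: "T > 0 \<Longrightarrow> 0 \<in> carrier (H1 T)"
  using is_primitive_zero by (auto simp: mem_carrier_H1_iff zero_fun_def)

lemma carrier_H1_sum:
  assumes "\<And>i. i \<in> I \<Longrightarrow> f i \<in> carrier (H1 T)" "T > 0"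
  shows "sum f I \<in> carrier (H1 T)"
  using assms by (induction I rule: infinite_finite_induct) (simp_all add: carrier_H1_0 carrier_H1_add)

lemma nrm_H1_0: "T > 0 \<Longrightarrow> nrm (H1 T) 0 = 0"
proof -
  assume T: "T > 0"
  have "is_primitive T 0 (\<lambda>t. 0 :: 'a)"
    unfolding zero_fun_def by (rule is_primitive_zero)
  from nrm_H1_eq[OF carrier_H1_0[OF T] this T] show ?thesis
    by (simp add: L2_norm_def)
qed

text \<open>The factor 4 arises as 2 from \<open>square_integrable_dominated\<close> and 2 from
  bounding the L2 norms of a function and of its derivative separately by the H1 norm.\<close>

lemma nrm_H1_add:
  assumes f: "f \<in> carrier (H1 T)" and g: "g \<in> carrier (H1 T)" and T: "T > 0"
  shows "nrm (H1 T) (f + g) \<le> 4 * (nrm (H1 T) f + nrm (H1 T) g)"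
proof -
  obtain v w where v: "is_primitive T f v" and w: "is_primitive T g w"
    using f g by (auto simp: mem_carrier_H1_iff[OF T])
  have vw: "is_primitive T (f + g) (\<lambda>t. v t + w t)"
    unfolding plus_fun_def by (rule is_primitive_add[OF v w])
  have "L2_norm T (\<lambda>t. a t + b t) \<le> 2 * 1 * L2_norm T a + 2 * 1 * L2_norm T b"
    if "square_integrable T a" "square_integrable T b" for a b :: "real \<Rightarrow> 'a"
    using that by (intro square_integrable_dominated(2)) (auto simp: square_integrable_def norm_triangle_ineq)
  from this[of f g] this[of v w]
  have "L2_norm T (f + g) \<le> 2 * L2_norm T f + 2 * L2_norm T g"
    "L2_norm T (\<lambda>t. v t + w t) \<le> 2 * L2_norm T v + 2 * L2_norm T w"
    using is_primitive_square_integrable[OF v] is_primitive_square_integrable[OF w]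
    by (auto simp: plus_fun_def)
  then have "L2_norm T (f + g) + L2_norm T (\<lambda>t. v t + w t) \<le> 4 * (nrm (H1 T) f + nrm (H1 T) g)"
    using nrm_H1_bounds(1,2)[OF f v T] nrm_H1_bounds(1,2)[OF g w T] by (simp add: distrib_left)
  with nrm_H1_bounds(3)[OF carrier_H1_add[OF f g T] vw T] show ?thesis by (rule order_trans)
qed

text \<open>The constant is obtained before the family \<open>f\<close>. It comes from iterating
  \<open>nrm_H1_add\<close>, each further index replacing \<open>C\<close> by
  \<open>4 * (C + 1)\<close>.\<close>

lemma nrm_H1_sum:
  assumes T: "T > 0" and "finite I"
  obtains C where "C > 0" "\<And>f :: 'i \<Rightarrow> real \<Rightarrow> 'a::euclidean_space.
    (\<And>i. i \<in> I \<Longrightarrow> f i \<in> carrier (H1 T)) \<Longrightarrow> nrm (H1 T) (sum f I) \<le> C * (\<Sum>i\<in>I. nrm (H1 T) (f i))"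
proof -
  have "\<exists>C>0. \<forall>f :: 'i \<Rightarrow> real \<Rightarrow> 'a. (\<forall>i\<in>I. f i \<in> carrier (H1 T)) \<longrightarrow>
      nrm (H1 T) (sum f I) \<le> C * (\<Sum>i\<in>I. nrm (H1 T) (f i))"
    using \<open>finite I\<close>
  proof (induction I)
    case empty
    then show ?case by (intro exI[of _ 1]) (simp add: nrm_H1_0[OF T, unfolded zero_fun_def])
  next
    case (insert a I)
    then obtain C where C: "C > 0" "\<And>f :: 'i \<Rightarrow> real \<Rightarrow> 'a. (\<forall>i\<in>I. f i \<in> carrier (H1 T)) \<Longrightarrow>
      nrm (H1 T) (sum f I) \<le> C * (\<Sum>i\<in>I. nrm (H1 T) (f i))" by blast
    show ?case
    proof (intro exI[of _ "4 * (C + 1)"] conjI allI impI)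
      fix f :: "'i \<Rightarrow> real \<Rightarrow> 'a" assume f: "\<forall>i\<in>insert a I. f i \<in> carrier (H1 T)"
      have "nrm (H1 T) (f a + sum f I) \<le> 4 * (nrm (H1 T) (f a) + nrm (H1 T) (sum f I))"
        using f by (intro nrm_H1_add carrier_H1_sum T) auto
      also have "\<dots> \<le> 4 * (nrm (H1 T) (f a) + C * (\<Sum>i\<in>I. nrm (H1 T) (f i)))"
        using C(2)[of f] f by simp
      also have "\<dots> \<le> 4 * (C + 1) * (nrm (H1 T) (f a) + (\<Sum>i\<in>I. nrm (H1 T) (f i)))"
        using C(1) nrm_H1_nonneg[of T "f a"] sum_nonneg[of I "\<lambda>i. nrm (H1 T) (f i)"]
        by (simp add: nrm_H1_nonneg algebra_simps)
      finally show "nrm (H1 T) (sum f (insert a I)) \<le> 4 * (C + 1) * (\<Sum>i\<in>insert a I. nrm (H1 T) (f i))"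
        using insert by simp
    qed (use C in simp)
  qed
  then show thesis using that by blast
qed

text \<open>With \<open>S\<close> the embedding constant, the values of a product contribute
  \<open>sqrt T * S\<^sup>2\<close>. Each of the two terms of the product rule contributes
  \<open>2 * S\<close>: one factor is bounded by the embedding, the other one is a derivative in
  L2.\<close>

definition H1_mult_const :: "real \<Rightarrow> real" where
  "H1_mult_const T = sqrt T * (H1_sup_const T)\<^sup>2 + 4 * H1_sup_const T"

lemma H1_mult_const_pos: "T > 0 \<Longrightarrow> H1_mult_const T > 0"
  using H1_sup_const_pos[of T] by (auto simp: H1_mult_const_def intro!: add_nonneg_pos)

lemma carrier_H1_mult:
  fixes f g :: "real \<Rightarrow> real"
  assumes f: "f \<in> carrier (H1 T)" and g: "g \<in> carrier (H1 T)" and T: "T > 0"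
  shows "f * g \<in> carrier (H1 T)"
    "nrm (H1 T) (f * g) \<le> H1_mult_const T * nrm (H1 T) f * nrm (H1 T) g"
proof -
  obtain v w where v: "is_primitive T f v" and w: "is_primitive T g w"
    using f g by (auto simp: mem_carrier_H1_iff[OF T])
  have vw: "is_primitive T (f * g) (\<lambda>t. f t * w t + v t * g t)"
    using is_primitive_scaleR[OF v w] by (simp add: times_fun_def)
  show fg: "f * g \<in> carrier (H1 T)"
    using vw carrier_H1_vanishes[OF f] by (auto simp: mem_carrier_H1_iff[OF T])
  define a b S where "a = nrm (H1 T) f" "b = nrm (H1 T) g" "S = H1_sup_const T"
  have nn: "0 \<le> a" "0 \<le> b" "0 < S"
    using nrm_H1_nonneg H1_sup_const_pos[OF T] by (auto simp: a_b_S_def)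
  have sup: "\<bar>f t\<bar> \<le> S * a" "\<bar>g t\<bar> \<le> S * b" for t
    using norm_le_nrm_H1[OF f T, of t] norm_le_nrm_H1[OF g T, of t] by (auto simp: a_b_S_def)
  have "nrm (H1 T) (f * g) \<le> sqrt T * ((S * a) * (S * b)) + 2 * (S * a) * L2_norm T w + 2 * (S * b) * L2_norm T v"
  proof (rule nrm_H1_le[OF fg vw T])
    show "norm ((f * g) t) \<le> (S * a) * (S * b)" for t
      using sup[of t] nn by (simp add: abs_mult mult_mono)
    show "norm (f t * w t + v t * g t) \<le> S * a * norm (w t) + S * b * norm (v t)" for t
    proof -
      have "\<bar>f t * w t\<bar> \<le> S * a * \<bar>w t\<bar>" "\<bar>v t * g t\<bar> \<le> S * b * \<bar>v t\<bar>"
        using sup[of t] by (auto simp: abs_mult mult.commute[of "\<bar>v t\<bar>"] intro!: mult_right_mono)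
      then show ?thesis by simp
    qed
  qed (use is_primitive_square_integrable[OF v] is_primitive_square_integrable[OF w] nn in auto)
  also have "\<dots> \<le> sqrt T * ((S * a) * (S * b)) + 2 * (S * a) * b + 2 * (S * b) * a"
    unfolding a_b_S_def(1,2) using nrm_H1_bounds(2)[OF f v T] nrm_H1_bounds(2)[OF g w T] nn
    by (intro add_mono mult_left_mono) (use T in \<open>auto simp: a_b_S_def\<close>)
  also have "\<dots> = H1_mult_const T * a * b"
    by (simp add: H1_mult_const_def a_b_S_def(3) power2_eq_square algebra_simps)
  finally show "nrm (H1 T) (f * g) \<le> H1_mult_const T * nrm (H1 T) f * nrm (H1 T) g"
    by (simp add: a_b_S_def)
qed

lemma carrier_H1_inner:
  assumes f: "f \<in> carrier (H1 T)" and T: "T > 0"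
  shows "(\<lambda>t. f t \<bullet> b) \<in> carrier (H1 T)"
    "nrm (H1 T) (\<lambda>t. f t \<bullet> b) \<le> 4 * norm b * nrm (H1 T) f"
proof -
  obtain v where v: "is_primitive T f v"
    using f by (auto simp: mem_carrier_H1_iff[OF T])
  have vb: "is_primitive T (\<lambda>t. f t \<bullet> b) (\<lambda>t. v t \<bullet> b)"
    using v by (intro is_primitive_bounded_linear[of "\<lambda>x. x \<bullet> b"] bounded_linear_inner_left)
  show fb: "(\<lambda>t. f t \<bullet> b) \<in> carrier (H1 T)"
    using vb carrier_H1_vanishes[OF f] by (auto simp: mem_carrier_H1_iff[OF T])
  have le: "L2_norm T (\<lambda>t. a t \<bullet> b) \<le> 2 * norm b * L2_norm T a + 2 * 0 * L2_norm T a"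
    if "square_integrable T a" for a
    using that by (intro square_integrable_dominated(2))
      (auto simp: square_integrable_def mult.commute[of "norm b"] intro: Cauchy_Schwarz_ineq2)
  have "L2_norm T (\<lambda>t. f t \<bullet> b) \<le> 2 * norm b * L2_norm T f" "L2_norm T (\<lambda>t. v t \<bullet> b) \<le> 2 * norm b * L2_norm T v"
    using le[of f] le[of v] is_primitive_square_integrable[OF v] by auto
  then have "nrm (H1 T) (\<lambda>t. f t \<bullet> b) \<le> 2 * norm b * L2_norm T f + 2 * norm b * L2_norm T v"
    using nrm_H1_bounds(3)[OF fb vb T] by linarith
  also have "\<dots> \<le> 2 * norm b * nrm (H1 T) f + 2 * norm b * nrm (H1 T) f"
    using nrm_H1_bounds[OF f v T] by (intro add_mono mult_left_mono) auto
  finally show "nrm (H1 T) (\<lambda>t. f t \<bullet> b) \<le> 4 * norm b * nrm (H1 T) f" by simp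
qed

section \<open>Superposition operators\<close>

text \<open>The gauge \<open>N\<close> is a parameter because the minimum of finitely many radii is
  taken both for the Euclidean norm and for the norm of H1.\<close>

lemma finite_family_pos_bound:
  assumes "finite I" "\<And>i. i \<in> I \<Longrightarrow> \<exists>d>0::real. \<forall>x. N x < d \<longrightarrow> P i x"
  shows "\<exists>d>0. \<forall>x. N x < d \<longrightarrow> (\<forall>i\<in>I. P i x)"
  using assms
proof (induction I)
  case (insert a I)
  then obtain d d' where "d > 0" "\<forall>x. N x < d \<longrightarrow> (\<forall>i\<in>I. P i x)" "d' > 0" "\<forall>x. N x < d' \<longrightarrow> P a x"
    by (metis insertCI)
  then show ?case by (intro exI[of _ "min d d'"]) auto
qed (auto intro: exI[of _ 1])

text \<open>In \<open>\<phi>'' v x w\<close> the base point stands in the middle: it is the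
  derivative of \<open>\<lambda>x. \<phi>' x v\<close> at \<open>x\<close> in the direction
  \<open>w\<close>.\<close>

locale C2_function =
  fixes \<phi> :: "'a::euclidean_space \<Rightarrow> real" and \<phi>' :: "'a \<Rightarrow> 'a \<Rightarrow> real"
    and \<phi>'' :: "'a \<Rightarrow> 'a \<Rightarrow> 'a \<Rightarrow> real"
  assumes deriv1: "C1_deriv \<phi> \<phi>'" and deriv2: "\<And>v. C1_deriv (\<lambda>x. \<phi>' x v) (\<phi>'' v)"
begin

lemma sym: "\<phi>'' u x w = \<phi>'' w x u"
  by (rule symmetric_second_derivative[OF deriv1 deriv2])

lemma linear1: "linear (\<phi>' x)"
  by (rule C1_deriv_linear[OF deriv1])

text \<open>Symmetry turns linearity in the direction of differentiation into linearity in
  \<open>v\<close>.\<close>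

lemma linear2: "linear (\<lambda>v. \<phi>'' v x w)"
  using C1_deriv_linear[OF deriv2] by (subst sym)

text \<open>A first-order expansion of \<open>\<phi>'\<close>, uniform over \<open>K\<close> and
  with an error proportional to \<open>norm v\<close>: later \<open>v\<close> is the weak derivative
  of \<open>\<gamma>\<close>, which need not be bounded. The remainder is linear in
  \<open>v\<close>, so it suffices to treat basis vectors.\<close>

lemma derivative_near_compact:
  assumes K: "compact K" and e: "e > 0"
  shows "\<exists>d>0. \<forall>y. norm y < d \<longrightarrow> (\<forall>x\<in>K. \<forall>v.
    \<bar>\<phi>' (x + y) v - \<phi>' x v - \<phi>'' v x y\<bar> \<le> e * norm y * norm v)"
proof -
  define n where "n = real (card (Basis :: 'a set))"
  have n: "n > 0" by (simp add: n_def)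
  have "\<exists>d>0. \<forall>y. norm y < d \<longrightarrow> (\<forall>x\<in>K. \<bar>\<phi>' (x + y) b - \<phi>' x b - \<phi>'' b x y\<bar> \<le> e / n * norm y)" for b
  proof -
    have en: "e / n > 0" using e n by simp
    obtain d where d: "d > 0"
      "\<And>x y v. x \<in> K \<Longrightarrow> norm y < d \<Longrightarrow> norm (\<phi>'' b (x + y) v - \<phi>'' b x v) \<le> e / n * norm v"
      using C1_deriv_near_compact[OF deriv2 K en] by blast
    show ?thesis
    proof (intro exI[of _ d] conjI allI impI ballI d(1))
      fix y x :: 'a assume "norm y < d" "x \<in> K"
      then show "\<bar>\<phi>' (x + y) b - \<phi>' x b - \<phi>'' b x y\<bar> \<le> e / n * norm y"
        using C1_deriv_linearization[OF deriv2, of "e / n" d b x y 0] d en by simp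
    qed
  qed
  from finite_family_pos_bound[where N = norm and P = "\<lambda>b y. \<forall>x\<in>K. \<bar>\<phi>' (x + y) b - \<phi>' x b - \<phi>'' b x y\<bar> \<le> e / n * norm y", OF finite_Basis this] obtain d where d1: "d > 0"
    and d2: "\<forall>y. norm y < d \<longrightarrow> (\<forall>b\<in>Basis. \<forall>x\<in>K. \<bar>\<phi>' (x + y) b - \<phi>' x b - \<phi>'' b x y\<bar> \<le> e / n * norm y)"
    by (elim exE conjE)
  note d = d1 d2[rule_format]
  show ?thesis
  proof (intro exI[of _ d] conjI allI impI ballI d(1))
    fix y x v :: 'a assume *: "norm y < d" "x \<in> K"
    have "linear (\<lambda>v. \<phi>' (x + y) v - \<phi>' x v - \<phi>'' v x y)"
      by (intro linear_compose_sub linear1 linear2)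
    from linear_norm_le_sum_Basis[OF this, of v]
    have "\<bar>\<phi>' (x + y) v - \<phi>' x v - \<phi>'' v x y\<bar> \<le> (\<Sum>b\<in>Basis. \<bar>\<phi>' (x + y) b - \<phi>' x b - \<phi>'' b x y\<bar>) * norm v"
      by simp
    also have "\<dots> \<le> (\<Sum>b\<in>(Basis::'a set). e / n * norm y) * norm v"
      using * by (intro mult_right_mono sum_mono d(2)) auto
    also have "\<dots> = e * norm y * norm v"
      using n by (simp add: n_def)
    finally show "\<bar>\<phi>' (x + y) v - \<phi>' x v - \<phi>'' v x y\<bar> \<le> e * norm y * norm v" .
  qed
qed

text \<open>In the basis expansion of \<open>\<phi>' (\<gamma> t) (h t)\<close> every summand is a
  product of a coordinate of \<open>h\<close> and a superposition with \<open>\<gamma>\<close>.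
  Symmetry moves \<open>v t\<close> into the first argument of \<open>\<phi>''\<close>, the form in
  which it meets the expansion of \<open>\<phi>' (\<gamma> t + h t) (v t)\<close>.\<close>

lemma is_primitive_derivative:
  assumes g: "is_primitive T \<gamma> v" and h: "is_primitive T h k"
  shows "is_primitive T (\<lambda>t. \<phi>' (\<gamma> t) (h t)) (\<lambda>t. \<phi>'' (v t) (\<gamma> t) (h t) + \<phi>' (\<gamma> t) (k t))"
proof -
  have "is_primitive T (\<lambda>t. \<Sum>b\<in>Basis. (h t \<bullet> b) *\<^sub>R \<phi>' (\<gamma> t) b)
      (\<lambda>t. \<Sum>b\<in>Basis. (h t \<bullet> b) *\<^sub>R \<phi>'' b (\<gamma> t) (v t) + (k t \<bullet> b) *\<^sub>R \<phi>' (\<gamma> t) b)"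
    by (intro is_primitive_sum is_primitive_scaleR is_primitive_chain_rule[OF deriv2 g]
        is_primitive_bounded_linear[OF bounded_linear_inner_left h])
  moreover have "(\<lambda>t. \<phi>' (\<gamma> t) (h t)) = (\<lambda>t. \<Sum>b\<in>Basis. (h t \<bullet> b) *\<^sub>R \<phi>' (\<gamma> t) b)"
    by (rule ext) (rule linear_eq_sum_Basis[OF linear1])
  moreover have "(\<lambda>t. \<phi>'' (v t) (\<gamma> t) (h t) + \<phi>' (\<gamma> t) (k t))
      = (\<lambda>t. \<Sum>b\<in>Basis. (h t \<bullet> b) *\<^sub>R \<phi>'' b (\<gamma> t) (v t) + (k t \<bullet> b) *\<^sub>R \<phi>' (\<gamma> t) b)"
    unfolding sum.distrib
    by (intro ext arg_cong2[where f = "(+)"] linear_eq_sum_Basis[OF linear1])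
      (subst sym, rule linear_eq_sum_Basis[OF linear2])
  ultimately show ?thesis by (simp only:)
qed

end

definition nemytskii :: "real \<Rightarrow> ('a \<Rightarrow> 'b::zero) \<Rightarrow> (real \<Rightarrow> 'a) \<Rightarrow> real \<Rightarrow> 'b" where
  "nemytskii T \<phi> \<gamma> = zero_ext {0..T} (\<phi> \<circ> \<gamma>)"

lemma nemytskii_in_H1:
  assumes \<phi>: "C1_deriv \<phi> \<phi>'" and g: "\<gamma> \<in> carrier (H1 T)" and T: "T > 0"
  shows "nemytskii T \<phi> \<gamma> \<in> carrier (H1 T)"
proof -
  obtain v where "is_primitive T \<gamma> v"
    using g by (auto simp: mem_carrier_H1_iff[OF T])
  then show ?thesis
    unfolding nemytskii_def o_def
    by (intro zero_ext_in_carrier_H1(1)[OF is_primitive_chain_rule[OF \<phi>] T])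
qed

text \<open>The derivative of the increment is \<open>(\<phi>' (\<gamma> + h) - \<phi>' \<gamma>) v
  + \<phi>' (\<gamma> + h) k\<close>. In the first term the factor is uniformly small because
  \<open>h\<close> is small in the sup norm; in the second the factor is bounded and
  \<open>k\<close> is small in L2.\<close>

lemma nemytskii_continuous:
  assumes \<phi>: "C1_deriv \<phi> \<phi>'" and g: "\<gamma> \<in> carrier (H1 T)" and T: "T > 0" and e: "e > 0"
  shows "\<exists>d>0. \<forall>h. nrm (H1 T) h < d \<longrightarrow> h \<in> carrier (H1 T) \<longrightarrow>
    nrm (H1 T) (nemytskii T \<phi> (\<gamma> + h) - nemytskii T \<phi> \<gamma>) \<le> e"
proof -
  obtain v where v: "is_primitive T \<gamma> v"
    using g by (auto simp: mem_carrier_H1_iff[OF T])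
  define K where "K = \<gamma> ` {0..T}"
  have K: "compact K"
    unfolding K_def using is_primitive_continuous_on[OF v] by (intro compact_continuous_image) auto
  obtain B where B: "B > 0" "\<And>x u. x \<in> K \<Longrightarrow> norm (\<phi>' x u) \<le> B * norm u"
    using C1_deriv_bound_compact[OF \<phi> K] by blast
  define N S where "N = nrm (H1 T) \<gamma>" and "S = H1_sup_const T"
  have N: "N \<ge> 0" and S: "S > 0"
    using nrm_H1_nonneg H1_sup_const_pos[OF T] by (auto simp: N_def S_def)
  \<comment> \<open>The term containing \<open>v\<close> contributes \<open>2 * c * N\<close>, which
    this choice keeps below \<open>e / 2\<close>.\<close>
  define c where "c = e / (4 * (N + 1))"
  have c: "c > 0" using e N by (simp add: c_def)
  obtain d where d: "d > 0"
    "\<And>x y u. x \<in> K \<Longrightarrow> norm y < d \<Longrightarrow> norm (\<phi>' (x + y) u - \<phi>' x u) \<le> c * norm u"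
    using C1_deriv_near_compact[OF \<phi> K c] by blast
  \<comment> \<open>The total factor of \<open>nrm (H1 T) h\<close>: the first summand stems from
    the values of the increment, the second from the derivative \<open>k\<close> of
    \<open>h\<close>. Near \<open>K\<close> the derivative \<open>\<phi>'\<close> is bounded by
    \<open>B + c\<close>.\<close>
  define M where "M = sqrt T * ((B + c) * S) + 2 * (B + c)"
  have M: "M > 0" using B(1) c S T unfolding M_def by (intro add_nonneg_pos) auto
  show ?thesis
  proof (intro exI[of _ "min (d / S) (e / (2 * M))"] conjI allI impI)
    show "min (d / S) (e / (2 * M)) > 0" using d(1) S e M by simp
    fix h :: "real \<Rightarrow> 'a" assume h: "nrm (H1 T) h < min (d / S) (e / (2 * M))" "h \<in> carrier (H1 T)"
    define n where "n = nrm (H1 T) h"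
    have n: "n \<ge> 0" by (simp add: n_def nrm_H1_nonneg)
    have nS: "S * n < d" "n * M \<le> e / 2"
      using h(1) S M by (auto simp: n_def field_simps)
    obtain k where k: "is_primitive T h k"
      using h(2) by (auto simp: mem_carrier_H1_iff[OF T])
    have hn: "norm (h t) \<le> S * n" for t
      unfolding S_def n_def by (rule norm_le_nrm_H1[OF h(2) T])
    then have hd: "norm (h t) < d" for t
      using nS(1) by (rule le_less_trans)
    have bound: "norm (\<phi>' (\<gamma> t + y) u) \<le> (B + c) * norm u" if "t \<in> {0..T}" "norm y < d" for t y u
    proof -
      have "\<gamma> t \<in> K" using that by (simp add: K_def)
      from d(2)[OF this that(2), of u] B(2)[OF this, of u] show ?thesis
        using norm_triangle_ineq2[of "\<phi>' (\<gamma> t + y) u" "\<phi>' (\<gamma> t) u"] by (simp add: distrib_right)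
    qed
    define r where "r t = \<phi> ((\<gamma> + h) t) - \<phi> (\<gamma> t)" for t
    have prim: "is_primitive T r (\<lambda>t. \<phi>' ((\<gamma> + h) t) (v t + k t) - \<phi>' (\<gamma> t) (v t))"
      unfolding r_def plus_fun_def
      by (intro is_primitive_diff is_primitive_chain_rule[OF \<phi>] is_primitive_add v k)
    have "nrm (H1 T) (zero_ext {0..T} r) \<le> sqrt T * ((B + c) * (S * n)) + 2 * c * L2_norm T v + 2 * (B + c) * L2_norm T k"
    proof (rule nrm_H1_le[OF zero_ext_in_carrier_H1[OF prim T] T])
      show "square_integrable T v" "square_integrable T k"
        using v k by (auto dest: is_primitive_square_integrable)
      show "0 \<le> (B + c) * (S * n)" "0 \<le> c" "0 \<le> B + c"
        using B(1) c S n by auto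
      fix t assume t: "t \<in> {0..T}"
      have "norm (\<phi> (\<gamma> t + h t) - \<phi> (\<gamma> t)) \<le> (B + c) * norm (h t)"
      proof -
        have "norm (\<phi> (\<gamma> t + h t) - \<phi> (\<gamma> t + 0) - \<phi>' (\<gamma> t) (h t - 0)) \<le> c * norm (h t - 0)"
        proof (rule C1_deriv_linearization[OF \<phi>, where d = d])
          show "norm (\<phi>' (\<gamma> t + y) u - \<phi>' (\<gamma> t) u) \<le> c * norm u" if "norm y < d" for y u
            using t that by (intro d(2)) (simp_all add: K_def)
        qed (use c d(1) hd in auto)
        moreover have "norm (\<phi>' (\<gamma> t) (h t)) \<le> B * norm (h t)"
          using t by (intro B(2)) (simp add: K_def)
        ultimately show ?thesis
          using norm_triangle_ineq2[of "\<phi> (\<gamma> t + h t) - \<phi> (\<gamma> t)" "\<phi>' (\<gamma> t) (h t)"] by (simp add: distrib_right)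
      qed
      also have "\<dots> \<le> (B + c) * (S * n)"
        using B(1) c by (intro mult_left_mono hn) auto
      finally show "norm (zero_ext {0..T} r t) \<le> (B + c) * (S * n)"
        using t by (simp add: zero_ext_def r_def)
    next
      fix t assume "t \<in> {0<..<T}"
      then have t: "t \<in> {0..T}" by simp
      have "norm (\<phi>' (\<gamma> t + h t) (v t) - \<phi>' (\<gamma> t) (v t)) \<le> c * norm (v t)"
        using t hd by (intro d(2)) (simp_all add: K_def)
      moreover have "norm (\<phi>' (\<gamma> t + h t) (k t)) \<le> (B + c) * norm (k t)"
        by (rule bound[OF t hd])
      ultimately have "norm ((\<phi>' (\<gamma> t + h t) (v t) - \<phi>' (\<gamma> t) (v t)) + \<phi>' (\<gamma> t + h t) (k t))
          \<le> c * norm (v t) + (B + c) * norm (k t)"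
        by (intro norm_triangle_le add_mono)
      then show "norm (\<phi>' ((\<gamma> + h) t) (v t + k t) - \<phi>' (\<gamma> t) (v t)) \<le> c * norm (v t) + (B + c) * norm (k t)"
        by (simp add: linear_add[OF C1_deriv_linear[OF \<phi>]] algebra_simps)
    qed
    also have "\<dots> \<le> sqrt T * ((B + c) * (S * n)) + 2 * c * N + 2 * (B + c) * n"
      using nrm_H1_bounds(2)[OF g v T] nrm_H1_bounds(2)[OF h(2) k T] B(1) c
      by (intro add_mono mult_left_mono) (use T S n in \<open>auto simp: N_def n_def\<close>)
    also have "\<dots> = n * M + 2 * c * N"
      by (simp add: M_def algebra_simps)
    also have "\<dots> \<le> e / 2 + e / 2"
      using N e nS(2) by (intro add_mono) (auto simp: c_def field_simps)
    finally have "nrm (H1 T) (zero_ext {0..T} r) \<le> e" by simp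
    also have "zero_ext {0..T} r = nemytskii T \<phi> (\<gamma> + h) - nemytskii T \<phi> \<gamma>"
      by (auto simp: nemytskii_def zero_ext_def r_def fun_eq_iff)
    finally show "nrm (H1 T) (nemytskii T \<phi> (\<gamma> + h) - nemytskii T \<phi> \<gamma>) \<le> e" .
  qed
qed

text \<open>The derivative of the remainder is regrouped as \<open>(\<phi>' (\<gamma> + h) v -
  \<phi>' \<gamma> v - \<phi>'' v \<gamma> h) + (\<phi>' (\<gamma> + h) k - \<phi>' \<gamma>
  k)\<close>. The first group is a small multiple of \<open>norm h * norm v\<close>, with
  \<open>h\<close> bounded by its H1 norm; the second is a small multiple of \<open>norm k\<close>.
  Both are therefore small compared with the H1 norm of \<open>h\<close>.\<close>

lemma (in C2_function) nemytskii_differentiable: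
  assumes g: "\<gamma> \<in> carrier (H1 T)" and T: "T > 0" and e: "e > 0"
  shows "\<exists>d>0. \<forall>h. nrm (H1 T) h < d \<longrightarrow> h \<in> carrier (H1 T) \<longrightarrow>
    nrm (H1 T) (nemytskii T \<phi> (\<gamma> + h) - nemytskii T \<phi> \<gamma> - zero_ext {0..T} (\<lambda>t. \<phi>' (\<gamma> t) (h t)))
      \<le> e * nrm (H1 T) h"
proof -
  obtain v where v: "is_primitive T \<gamma> v"
    using g by (auto simp: mem_carrier_H1_iff[OF T])
  define K where "K = \<gamma> ` {0..T}"
  have K: "compact K"
    unfolding K_def using is_primitive_continuous_on[OF v] by (intro compact_continuous_image) auto
  define N S where "N = nrm (H1 T) \<gamma>" and "S = H1_sup_const T"
  have N: "N \<ge> 0" and S: "S > 0"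
    using nrm_H1_nonneg H1_sup_const_pos[OF T] by (auto simp: N_def S_def)
  \<comment> \<open>The factors of \<open>c * nrm (H1 T) h\<close> are \<open>sqrt T * S\<close>
    from the values of the remainder, \<open>2 * S * N\<close> from the group containing
    \<open>v\<close>, and 2 from the group containing \<open>k\<close>.\<close>
  define M where "M = sqrt T * S + 2 * S * N + 2"
  have M: "M > 0" using N S T unfolding M_def by (intro add_nonneg_pos add_nonneg_nonneg) auto
  define c where "c = e / M"
  have c: "c > 0" using e M by (simp add: c_def)
  obtain d1 where d1: "d1 > 0"
    "\<And>x y u. x \<in> K \<Longrightarrow> norm y < d1 \<Longrightarrow> norm (\<phi>' (x + y) u - \<phi>' x u) \<le> c * norm u"
    using C1_deriv_near_compact[OF deriv1 K c] by blast
  obtain d2 where d2: "d2 > 0"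
    "\<And>x y u. x \<in> K \<Longrightarrow> norm y < d2 \<Longrightarrow> \<bar>\<phi>' (x + y) u - \<phi>' x u - \<phi>'' u x y\<bar> \<le> c * norm y * norm u"
    using derivative_near_compact[OF K c] by blast
  define d where "d = min d1 d2"
  have d: "d > 0" using d1(1) d2(1) by (simp add: d_def)
  show ?thesis
  proof (intro exI[of _ "d / S"] conjI allI impI)
    show "d / S > 0" using d S by simp
    fix h :: "real \<Rightarrow> 'a" assume h: "nrm (H1 T) h < d / S" "h \<in> carrier (H1 T)"
    define n where "n = nrm (H1 T) h"
    have n: "n \<ge> 0" by (simp add: n_def nrm_H1_nonneg)
    have nS: "S * n < d" using h(1) S by (simp add: n_def field_simps)
    obtain k where k: "is_primitive T h k"
      using h(2) by (auto simp: mem_carrier_H1_iff[OF T])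
    have hn: "norm (h t) \<le> S * n" for t
      unfolding S_def n_def by (rule norm_le_nrm_H1[OF h(2) T])
    then have "norm (h t) < d" for t
      using nS by (rule le_less_trans)
    then have hd: "norm (h t) < d1" "norm (h t) < d2" for t
      by (auto simp: d_def)
    define r where "r t = \<phi> ((\<gamma> + h) t) - \<phi> (\<gamma> t) - \<phi>' (\<gamma> t) (h t)" for t
    have prim: "is_primitive T r (\<lambda>t. \<phi>' ((\<gamma> + h) t) (v t + k t) - \<phi>' (\<gamma> t) (v t)
        - (\<phi>'' (v t) (\<gamma> t) (h t) + \<phi>' (\<gamma> t) (k t)))"
      unfolding r_def plus_fun_def
      by (intro is_primitive_diff is_primitive_chain_rule[OF deriv1] is_primitive_derivative is_primitive_add v k)
    have "nrm (H1 T) (zero_ext {0..T} r) \<le> sqrt T * (c * (S * n)) + 2 * (c * (S * n)) * L2_norm T v + 2 * c * L2_norm T k"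
    proof (rule nrm_H1_le[OF zero_ext_in_carrier_H1[OF prim T] T])
      show "square_integrable T v" "square_integrable T k"
        using v k by (auto dest: is_primitive_square_integrable)
      show "0 \<le> c * (S * n)" "0 \<le> c * (S * n)" "0 \<le> c"
        using c S n by auto
      fix t assume t: "t \<in> {0..T}"
      have "norm (\<phi> (\<gamma> t + h t) - \<phi> (\<gamma> t + 0) - \<phi>' (\<gamma> t) (h t - 0)) \<le> c * norm (h t - 0)"
      proof (rule C1_deriv_linearization[OF deriv1, where d = d1])
        show "norm (\<phi>' (\<gamma> t + y) u - \<phi>' (\<gamma> t) u) \<le> c * norm u" if "norm y < d1" for y u
          using t that by (intro d1(2)) (simp_all add: K_def)
      qed (use c d1(1) hd in auto)
      also have "\<dots> \<le> c * (S * n)"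
        using c hn[of t] by simp
      finally show "norm (zero_ext {0..T} r t) \<le> c * (S * n)"
        using t by (simp add: zero_ext_def r_def)
    next
      fix t assume "t \<in> {0<..<T}"
      then have t: "\<gamma> t \<in> K" by (simp add: K_def)
      have "norm (\<phi>' (\<gamma> t + h t) (v t) - \<phi>' (\<gamma> t) (v t) - \<phi>'' (v t) (\<gamma> t) (h t)) \<le> c * norm (h t) * norm (v t)"
        using d2(2)[OF t hd(2)] by simp
      also have "\<dots> \<le> c * (S * n) * norm (v t)"
        using c hn by (intro mult_right_mono mult_left_mono) auto
      finally have "norm ((\<phi>' (\<gamma> t + h t) (v t) - \<phi>' (\<gamma> t) (v t) - \<phi>'' (v t) (\<gamma> t) (h t))
          + (\<phi>' (\<gamma> t + h t) (k t) - \<phi>' (\<gamma> t) (k t))) \<le> c * (S * n) * norm (v t) + c * norm (k t)"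
        by (intro norm_triangle_le add_mono d1(2)[OF t hd(1)])
      then show "norm (\<phi>' ((\<gamma> + h) t) (v t + k t) - \<phi>' (\<gamma> t) (v t)
          - (\<phi>'' (v t) (\<gamma> t) (h t) + \<phi>' (\<gamma> t) (k t))) \<le> c * (S * n) * norm (v t) + c * norm (k t)"
        by (simp add: linear_add[OF linear1] algebra_simps)
    qed
    also have "\<dots> \<le> sqrt T * (c * (S * n)) + 2 * (c * (S * n)) * N + 2 * c * n"
    proof -
      have "L2_norm T v \<le> N" "L2_norm T k \<le> n"
        unfolding N_def n_def by (rule nrm_H1_bounds(2)[OF g v T] nrm_H1_bounds(2)[OF h(2) k T])+
      then show ?thesis
        using c S n T by (intro add_mono mult_left_mono) auto
    qed
    also have "\<dots> = c * M * n"
      by (simp add: M_def algebra_simps)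
    also have "\<dots> = e * n" using M by (simp add: c_def)
    finally have "nrm (H1 T) (zero_ext {0..T} r) \<le> e * nrm (H1 T) h" by (simp add: n_def)
    also have "zero_ext {0..T} r = nemytskii T \<phi> (\<gamma> + h) - nemytskii T \<phi> \<gamma> - zero_ext {0..T} (\<lambda>t. \<phi>' (\<gamma> t) (h t))"
      by (auto simp: nemytskii_def zero_ext_def r_def fun_eq_iff)
    finally show "nrm (H1 T) (nemytskii T \<phi> (\<gamma> + h) - nemytskii T \<phi> \<gamma> - zero_ext {0..T} (\<lambda>t. \<phi>' (\<gamma> t) (h t)))
      \<le> e * nrm (H1 T) h" .
  qed
qed

section \<open>Multiplication operators and the derivatives\<close>

text \<open>A supremum of reals is controlled by an upper bound only if the set is nonempty; the
  zero vector supplies an element.\<close>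

lemma nrm_operator_space_le:
  assumes "0 \<in> carrier V" "nrm V 0 \<le> 1"
    and "\<And>x. x \<in> carrier V \<Longrightarrow> nrm V x \<le> 1 \<Longrightarrow> nrm W (A x) \<le> M"
  shows "nrm (operator_space V W) A \<le> M"
proof -
  have "{nrm W (A x) |x. x \<in> carrier V \<and> nrm V x \<le> 1} \<noteq> {}"
    using assms(1,2) by blast
  then have "Sup {nrm W (A x) |x. x \<in> carrier V \<and> nrm V x \<le> 1} \<le> M"
    by (rule cSup_least) (use assms(3) in blast)
  then show ?thesis by (simp add: operator_space_def)
qed

lemma nrm_operator_space_H1_le:
  assumes "T > 0" "0 \<le> M"
    and "\<And>x. x \<in> carrier (H1 T) \<Longrightarrow> nrm W (A x) \<le> M * nrm (H1 T) x"
  shows "nrm (operator_space (H1 T) W) A \<le> M"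
proof (rule nrm_operator_space_le)
  show "0 \<in> carrier (H1 T)" "nrm (H1 T) 0 \<le> 1"
    using assms(1) by (auto simp: carrier_H1_0 nrm_H1_0)
  show "nrm W (A x) \<le> M" if "x \<in> carrier (H1 T)" "nrm (H1 T) x \<le> 1" for x
    using assms(3)[OF that(1)] mult_left_mono[OF that(2) assms(2)] by simp
qed

definition mult_op :: "real \<Rightarrow> ('n::finite \<Rightarrow> real \<Rightarrow> real) \<Rightarrow> (real \<Rightarrow> real ^ 'n) \<Rightarrow> real \<Rightarrow> real" where
  "mult_op T m = zero_ext (carrier (H1 T)) (\<lambda>\<delta> t. \<Sum>j\<in>UNIV. m j t * \<delta> t $ j)"

text \<open>A bilinear form in curried shape: contracting the first index with
  \<open>\<delta>\<close> produces multipliers that lie in H1 again if the entries do, so the bound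
  for \<open>mult_op\<close> can be used twice.\<close>

definition mult_op2 ::
    "real \<Rightarrow> ('n::finite \<Rightarrow> 'n \<Rightarrow> real \<Rightarrow> real) \<Rightarrow> (real \<Rightarrow> real ^ 'n) \<Rightarrow> (real \<Rightarrow> real ^ 'n) \<Rightarrow> real \<Rightarrow> real" where
  "mult_op2 T m = zero_ext (carrier (H1 T)) (\<lambda>\<delta>. mult_op T (\<lambda>j. mult_op T (\<lambda>i. m i j) \<delta>))"

text \<open>Linearity in the multipliers, stated with its companions below, reduces differences of
  operators to operators whose multipliers are differences.\<close>

lemma mult_op_add: "mult_op T (\<lambda>j. m j + m' j) = mult_op T m + mult_op T m'"
  by (auto simp: mult_op_def zero_ext_def fun_eq_iff distrib_right sum.distrib)

lemma mult_op_diff: "mult_op T (\<lambda>j. m j - m' j) = mult_op T m - mult_op T m'"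
  by (auto simp: mult_op_def zero_ext_def fun_eq_iff left_diff_distrib sum_subtractf)

lemma mult_op_scaleR: "mult_op T (\<lambda>j. c *\<^sub>R m j) = c *\<^sub>R mult_op T m"
  by (auto simp: mult_op_def zero_ext_def fun_eq_iff scaleR_fun_def sum_distrib_left mult.assoc)

lemma mult_op_add_right:
  assumes "x \<in> carrier (H1 T)" "y \<in> carrier (H1 T)" "T > 0"
  shows "mult_op T m (x + y) = mult_op T m x + mult_op T m y"
  using assms carrier_H1_add[OF assms]
  by (auto simp: mult_op_def zero_ext_def fun_eq_iff distrib_left sum.distrib)

lemma mult_op_scaleR_right:
  assumes "x \<in> carrier (H1 T)" "T > 0"
  shows "mult_op T m (c *\<^sub>R x) = c *\<^sub>R mult_op T m x"
  using assms carrier_H1_scaleR[OF assms]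
  by (auto simp: mult_op_def zero_ext_def fun_eq_iff scaleR_fun_def sum_distrib_left mult.left_commute)

lemma mult_op2_diff: "mult_op2 T (\<lambda>i j. m i j - m' i j) = mult_op2 T m - mult_op2 T m'"
  by (auto simp: mult_op2_def zero_ext_def fun_eq_iff mult_op_diff)

lemma sum_fun_apply: "(sum f I) t = (\<Sum>i\<in>I. f i t)"
  by (induction I rule: infinite_finite_induct) auto

text \<open>The constant is uniform in multipliers and argument. It combines the constant for finite
  sums, the product constant \<open>K\<close> and the factor 4 for passing to a component of
  \<open>\<delta>\<close>.\<close>

lemma mult_op_bound:
  assumes T: "T > 0"
  obtains C where "C > 0"
    "\<And>(m :: 'n::finite \<Rightarrow> real \<Rightarrow> real) \<delta>. (\<And>j. m j \<in> carrier (H1 T)) \<Longrightarrow> \<delta> \<in> carrier (H1 T) \<Longrightarrow>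
      mult_op T m \<delta> \<in> carrier (H1 T) \<and>
      nrm (H1 T) (mult_op T m \<delta>) \<le> C * (\<Sum>j\<in>UNIV. nrm (H1 T) (m j)) * nrm (H1 T) \<delta>"
proof -
  obtain C where C: "C > 0" "\<And>f :: 'n \<Rightarrow> real \<Rightarrow> real.
      (\<And>i. i \<in> UNIV \<Longrightarrow> f i \<in> carrier (H1 T)) \<Longrightarrow> nrm (H1 T) (sum f UNIV) \<le> C * (\<Sum>i\<in>UNIV. nrm (H1 T) (f i))"
    using nrm_H1_sum[OF T, of "UNIV :: 'n set"] by auto
  define K where "K = H1_mult_const T"
  have K: "K > 0" using H1_mult_const_pos[OF T] by (simp add: K_def)
  show thesis
  proof (rule that[of "C * (K * 4)"])
    show "C * (K * 4) > 0" using C(1) K by simp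
    fix m :: "'n \<Rightarrow> real \<Rightarrow> real" and \<delta> :: "real \<Rightarrow> real ^ 'n"
    assume m: "\<And>j. m j \<in> carrier (H1 T)" and \<delta>: "\<delta> \<in> carrier (H1 T)"
    define f where "f j = m j * (\<lambda>t. \<delta> t \<bullet> axis j 1)" for j
    have eq: "mult_op T m \<delta> = sum f UNIV"
      using \<delta> by (auto simp: mult_op_def zero_ext_def f_def fun_eq_iff sum_fun_apply inner_axis)
    have f: "f j \<in> carrier (H1 T)" for j
      unfolding f_def by (intro carrier_H1_mult(1) carrier_H1_inner(1) m \<delta> T)
    have nf: "nrm (H1 T) (f j) \<le> nrm (H1 T) (m j) * (K * 4 * nrm (H1 T) \<delta>)" for j
    proof -
      have "nrm (H1 T) (f j) \<le> K * nrm (H1 T) (m j) * nrm (H1 T) (\<lambda>t. \<delta> t \<bullet> axis j 1)"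
        unfolding f_def K_def by (intro carrier_H1_mult(2) carrier_H1_inner(1) m \<delta> T)
      also have "\<dots> \<le> K * nrm (H1 T) (m j) * (4 * nrm (H1 T) \<delta>)"
        using K carrier_H1_inner(2)[OF \<delta> T, of "axis j 1"]
        by (intro mult_left_mono) (simp_all add: nrm_H1_nonneg)
      finally show ?thesis by (simp add: mult_ac)
    qed
    have "nrm (H1 T) (mult_op T m \<delta>) \<le> C * (\<Sum>j\<in>UNIV. nrm (H1 T) (f j))"
      unfolding eq by (rule C(2)) (rule f)
    also have "\<dots> \<le> C * (\<Sum>j\<in>UNIV. nrm (H1 T) (m j) * (K * 4 * nrm (H1 T) \<delta>))"
      using C(1) by (intro mult_left_mono sum_mono nf) auto
    also have "\<dots> = C * (K * 4) * (\<Sum>j\<in>UNIV. nrm (H1 T) (m j)) * nrm (H1 T) \<delta>"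
      unfolding sum_distrib_right[symmetric] by (simp only: mult_ac)
    finally show "mult_op T m \<delta> \<in> carrier (H1 T) \<and>
        nrm (H1 T) (mult_op T m \<delta>) \<le> C * (K * 4) * (\<Sum>j\<in>UNIV. nrm (H1 T) (m j)) * nrm (H1 T) \<delta>"
      unfolding eq using f T by (simp add: carrier_H1_sum)
  qed
qed

lemma mult_op_in_operator_space:
  fixes m :: "'n::finite \<Rightarrow> real \<Rightarrow> real"
  assumes m: "\<And>j. m j \<in> carrier (H1 T)" and T: "T > 0"
  shows "mult_op T m \<in> carrier (operator_space (H1 T) (H1 T))"
proof -
  obtain C where C: "\<And>(m :: 'n \<Rightarrow> real \<Rightarrow> real) \<delta>. (\<And>j. m j \<in> carrier (H1 T)) \<Longrightarrow> \<delta> \<in> carrier (H1 T) \<Longrightarrow>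
      mult_op T m \<delta> \<in> carrier (H1 T) \<and>
      nrm (H1 T) (mult_op T m \<delta>) \<le> C * (\<Sum>j\<in>UNIV. nrm (H1 T) (m j)) * nrm (H1 T) \<delta>"
    using mult_op_bound[OF T, where 'n = 'n] by blast
  have "bounded_operator (H1 T) (H1 T) (mult_op T m)"
    unfolding bounded_operator_def
    using C[of m, OF m] mult_op_add_right[OF _ _ T] mult_op_scaleR_right[OF _ T] by blast
  then show ?thesis
    by (auto simp: operator_space_def mult_op_def zero_ext_def)
qed

text \<open>Closeness of the multipliers in H1 thus becomes closeness of the operators in operator
  norm, which is how estimates for scalar superpositions reach \<open>DG\<close>.\<close>

lemma mult_op_norm_bound:
  assumes T: "T > 0"
  obtains C where "C > 0"
    "\<And>m :: 'n::finite \<Rightarrow> real \<Rightarrow> real. (\<And>j. m j \<in> carrier (H1 T)) \<Longrightarrow>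
      nrm (operator_space (H1 T) (H1 T)) (mult_op T m) \<le> C * (\<Sum>j\<in>UNIV. nrm (H1 T) (m j))"
proof -
  obtain C where C: "C > 0" "\<And>(m :: 'n \<Rightarrow> real \<Rightarrow> real) \<delta>. (\<And>j. m j \<in> carrier (H1 T)) \<Longrightarrow> \<delta> \<in> carrier (H1 T) \<Longrightarrow>
      mult_op T m \<delta> \<in> carrier (H1 T) \<and>
      nrm (H1 T) (mult_op T m \<delta>) \<le> C * (\<Sum>j\<in>UNIV. nrm (H1 T) (m j)) * nrm (H1 T) \<delta>"
    using mult_op_bound[OF T, where 'n = 'n] by blast
  show thesis
  proof (rule that[OF C(1)])
    fix m :: "'n \<Rightarrow> real \<Rightarrow> real" assume m: "\<And>j. m j \<in> carrier (H1 T)"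
    show "nrm (operator_space (H1 T) (H1 T)) (mult_op T m) \<le> C * (\<Sum>j\<in>UNIV. nrm (H1 T) (m j))"
      using C(1) C(2)[of m, OF m]
      by (intro nrm_operator_space_H1_le T) (simp_all add: sum_nonneg nrm_H1_nonneg)
  qed
qed

lemma mult_op2_bound:
  assumes T: "T > 0"
  obtains C where "C > 0"
    "\<And>(m :: 'n::finite \<Rightarrow> 'n \<Rightarrow> real \<Rightarrow> real) \<delta>. (\<And>i j. m i j \<in> carrier (H1 T)) \<Longrightarrow> \<delta> \<in> carrier (H1 T) \<Longrightarrow>
      nrm (operator_space (H1 T) (H1 T)) (mult_op2 T m \<delta>)
        \<le> C * (\<Sum>j\<in>UNIV. \<Sum>i\<in>UNIV. nrm (H1 T) (m i j)) * nrm (H1 T) \<delta>"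
proof -
  obtain C where C: "C > 0" "\<And>(m :: 'n \<Rightarrow> real \<Rightarrow> real) \<delta>. (\<And>j. m j \<in> carrier (H1 T)) \<Longrightarrow> \<delta> \<in> carrier (H1 T) \<Longrightarrow>
      mult_op T m \<delta> \<in> carrier (H1 T) \<and>
      nrm (H1 T) (mult_op T m \<delta>) \<le> C * (\<Sum>j\<in>UNIV. nrm (H1 T) (m j)) * nrm (H1 T) \<delta>"
    using mult_op_bound[OF T, where 'n = 'n] by blast
  obtain D where D: "D > 0" "\<And>m :: 'n \<Rightarrow> real \<Rightarrow> real. (\<And>j. m j \<in> carrier (H1 T)) \<Longrightarrow>
      nrm (operator_space (H1 T) (H1 T)) (mult_op T m) \<le> D * (\<Sum>j\<in>UNIV. nrm (H1 T) (m j))"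
    using mult_op_norm_bound[OF T, where 'n = 'n] by blast
  show thesis
  proof (rule that[of "D * C"])
    fix m :: "'n \<Rightarrow> 'n \<Rightarrow> real \<Rightarrow> real" and \<delta> :: "real \<Rightarrow> real ^ 'n"
    assume m: "\<And>i j. m i j \<in> carrier (H1 T)" and \<delta>: "\<delta> \<in> carrier (H1 T)"
    have row: "mult_op T (\<lambda>i. m i j) \<delta> \<in> carrier (H1 T)"
      "nrm (H1 T) (mult_op T (\<lambda>i. m i j) \<delta>) \<le> C * (\<Sum>i\<in>UNIV. nrm (H1 T) (m i j)) * nrm (H1 T) \<delta>" for j
      using C(2)[of "\<lambda>i. m i j", OF m \<delta>] by auto
    have "nrm (operator_space (H1 T) (H1 T)) (mult_op2 T m \<delta>)
        = nrm (operator_space (H1 T) (H1 T)) (mult_op T (\<lambda>j. mult_op T (\<lambda>i. m i j) \<delta>))"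
      using \<delta> by (simp add: mult_op2_def zero_ext_def)
    also have "\<dots> \<le> D * (\<Sum>j\<in>UNIV. nrm (H1 T) (mult_op T (\<lambda>i. m i j) \<delta>))"
      by (rule D(2)) (rule row)
    also have "\<dots> \<le> D * (\<Sum>j\<in>UNIV. C * (\<Sum>i\<in>UNIV. nrm (H1 T) (m i j)) * nrm (H1 T) \<delta>)"
      using D(1) by (intro mult_left_mono sum_mono row) auto
    also have "\<dots> = D * C * (\<Sum>j\<in>UNIV. \<Sum>i\<in>UNIV. nrm (H1 T) (m i j)) * nrm (H1 T) \<delta>"
      by (simp only: sum_distrib_left[symmetric] sum_distrib_right[symmetric] mult.assoc)
    finally show "nrm (operator_space (H1 T) (H1 T)) (mult_op2 T m \<delta>)
        \<le> D * C * (\<Sum>j\<in>UNIV. \<Sum>i\<in>UNIV. nrm (H1 T) (m i j)) * nrm (H1 T) \<delta>" .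
  qed (use C(1) D(1) in simp)
qed

lemma mult_op2_in_operator_space:
  fixes m :: "'n::finite \<Rightarrow> 'n \<Rightarrow> real \<Rightarrow> real"
  assumes m: "\<And>i j. m i j \<in> carrier (H1 T)" and T: "T > 0"
  shows "mult_op2 T m \<in> carrier (operator_space (H1 T) (operator_space (H1 T) (H1 T)))"
proof -
  obtain C where C: "\<And>(m :: 'n \<Rightarrow> real \<Rightarrow> real) \<delta>. (\<And>j. m j \<in> carrier (H1 T)) \<Longrightarrow> \<delta> \<in> carrier (H1 T) \<Longrightarrow>
      mult_op T m \<delta> \<in> carrier (H1 T) \<and>
      nrm (H1 T) (mult_op T m \<delta>) \<le> C * (\<Sum>j\<in>UNIV. nrm (H1 T) (m j)) * nrm (H1 T) \<delta>"
    using mult_op_bound[OF T, where 'n = 'n] by blast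
  obtain K where K: "\<And>\<delta>. \<delta> \<in> carrier (H1 T) \<Longrightarrow>
      nrm (operator_space (H1 T) (H1 T)) (mult_op2 T m \<delta>)
        \<le> K * (\<Sum>j\<in>UNIV. \<Sum>i\<in>UNIV. nrm (H1 T) (m i j)) * nrm (H1 T) \<delta>"
    using mult_op2_bound[OF T, where 'n = 'n] m by metis
  have "bounded_operator (H1 T) (operator_space (H1 T) (H1 T)) (mult_op2 T m)"
    unfolding bounded_operator_def
  proof (intro conjI ballI allI)
    show "mult_op2 T m ` carrier (H1 T) \<subseteq> carrier (operator_space (H1 T) (H1 T))"
    proof
      fix A assume "A \<in> mult_op2 T m ` carrier (H1 T)"
      then obtain \<delta> where \<delta>: "\<delta> \<in> carrier (H1 T)" "A = mult_op T (\<lambda>j. mult_op T (\<lambda>i. m i j) \<delta>)"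
        by (auto simp: mult_op2_def zero_ext_def)
      then show "A \<in> carrier (operator_space (H1 T) (H1 T))"
        using C[of "\<lambda>i. m i j" for j, OF m] T by (auto intro: mult_op_in_operator_space)
    qed
    show "mult_op2 T m (x + y) = mult_op2 T m x + mult_op2 T m y"
      if "x \<in> carrier (H1 T)" "y \<in> carrier (H1 T)" for x y
      using that carrier_H1_add[OF that T]
      by (simp add: mult_op2_def zero_ext_def mult_op_add_right[OF that T] mult_op_add)
    show "mult_op2 T m (c *\<^sub>R x) = c *\<^sub>R mult_op2 T m x" if "x \<in> carrier (H1 T)" for c x
      using that carrier_H1_scaleR[OF that T]
      by (simp add: mult_op2_def zero_ext_def mult_op_scaleR_right[OF that T] mult_op_scaleR)
    show "\<exists>K. \<forall>x\<in>carrier (H1 T). nrm (operator_space (H1 T) (H1 T)) (mult_op2 T m x) \<le> K * nrm (H1 T) x"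
      using K by blast
  qed
  moreover have "mult_op2 T m x = 0" if "x \<notin> carrier (H1 T)" for x
    using that by (simp add: mult_op2_def zero_ext_def)
  ultimately show ?thesis by (simp add: operator_space_def[of _ "operator_space _ _"])
qed

section \<open>From the classes C_k to derivatives of superpositions\<close>

lemma C_k_continuous_on: "C_k k f \<Longrightarrow> continuous_on UNIV f"
  by (cases k) (auto intro!: continuous_at_imp_continuous_on differentiable_imp_continuous_within)

lemma C_k_Suc_imp_C1_deriv:
  "C_k (Suc k) f \<Longrightarrow> C1_deriv f (\<lambda>x. frechet_derivative f (at x))"
  by (auto simp: C1_deriv_def intro: C_k_continuous_on frechet_derivative_works[THEN iffD1])

lemma C_k_Suc_Suc_imp_C2_function:
  "C_k (Suc (Suc k)) f \<Longrightarrow> C2_function f (\<lambda>x. frechet_derivative f (at x))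
     (\<lambda>v x. frechet_derivative (\<lambda>x. frechet_derivative f (at x) v) (at x))"
  using C_k.simps(2)[of "Suc k" f] by unfold_locales (blast intro: C_k_Suc_imp_C1_deriv)+

lemma C_k_partial_derivative: "C_k (Suc k) f \<Longrightarrow> C_k k (partial_derivative i f)"
  unfolding partial_derivative_def[abs_def] by simp

lemma linear_eq_sum_axis:
  fixes L :: "real ^ 'n::finite \<Rightarrow> real"
  assumes "linear L"
  shows "L v = (\<Sum>i\<in>UNIV. L (axis i 1) * v $ i)"
proof -
  have "L v = L (\<Sum>i\<in>UNIV. v $ i *\<^sub>R axis i 1)"
    using basis_expansion[of v] by (simp add: scalar_mult_eq_scaleR)
  also have "\<dots> = (\<Sum>i\<in>UNIV. L (axis i 1) * v $ i)"
    by (simp add: linear_sum[OF assms] linear_cmul[OF assms] mult.commute)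
  finally show ?thesis .
qed

text \<open>This connects the remainder estimate, which is free of coordinates, with the
  multiplication operators, whose norms are estimated through their multipliers.\<close>

lemma mult_op_partial_derivatives:
  fixes f :: "real ^ 'n::finite \<Rightarrow> real"
  assumes f: "C_k (Suc k) f" and h: "h \<in> carrier (H1 T)"
  shows "mult_op T (\<lambda>i. nemytskii T (partial_derivative i f) \<gamma>) h
    = zero_ext {0..T} (\<lambda>t. frechet_derivative f (at (\<gamma> t)) (h t))"
proof (rule ext)
  fix t
  have "frechet_derivative f (at (\<gamma> t)) (h t) = (\<Sum>i\<in>UNIV. frechet_derivative f (at (\<gamma> t)) (axis i 1) * h t $ i)"
    by (rule linear_eq_sum_axis[OF C1_deriv_linear[OF C_k_Suc_imp_C1_deriv[OF f]]])
  then show "mult_op T (\<lambda>i. nemytskii T (partial_derivative i f) \<gamma>) h t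
      = zero_ext {0..T} (\<lambda>t. frechet_derivative f (at (\<gamma> t)) (h t)) t"
    using h by (cases "t \<in> {0..T}") (auto simp: mult_op_def zero_ext_def nemytskii_def partial_derivative_def)
qed

text \<open>The two derivatives of \<open>f\<close> serve twice: they yield the remainder estimate,
  and they leave the partial derivatives continuously differentiable, so that the multipliers belong
  to H1.\<close>

lemma nemytskii_has_frechet_derivative:
  fixes f :: "real ^ 'n::finite \<Rightarrow> real"
  assumes f: "C_k (Suc (Suc k)) f" and g: "\<gamma> \<in> carrier (H1 T)" and T: "T > 0"
  shows "has_frechet_derivative (H1 T) (H1 T) (nemytskii T f)
    (mult_op T (\<lambda>i. nemytskii T (partial_derivative i f) \<gamma>)) \<gamma>"
proof -
  interpret C2_function f "\<lambda>x. frechet_derivative f (at x)"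
    "\<lambda>v x. frechet_derivative (\<lambda>x. frechet_derivative f (at x) v) (at x)"
    by (rule C_k_Suc_Suc_imp_C2_function[OF f])
  have "nemytskii T (partial_derivative i f) \<gamma> \<in> carrier (H1 T)" for i
    by (rule nemytskii_in_H1[OF C_k_Suc_imp_C1_deriv[OF C_k_partial_derivative[OF f]] g T])
  then have mem: "mult_op T (\<lambda>i. nemytskii T (partial_derivative i f) \<gamma>) \<in> carrier (operator_space (H1 T) (H1 T))"
    by (rule mult_op_in_operator_space[OF _ T])
  show ?thesis
    unfolding has_frechet_derivative_def
  proof (intro conjI allI impI mem)
    fix \<epsilon> :: real assume "\<epsilon> > 0"
    from nemytskii_differentiable[OF g T this] obtain d where d: "d > 0"
      "\<And>h. nrm (H1 T) h < d \<Longrightarrow> h \<in> carrier (H1 T) \<Longrightarrow>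
        nrm (H1 T) (nemytskii T f (\<gamma> + h) - nemytskii T f \<gamma>
          - zero_ext {0..T} (\<lambda>t. frechet_derivative f (at (\<gamma> t)) (h t))) \<le> \<epsilon> * nrm (H1 T) h"
      by blast
    then show "\<exists>\<delta>>0. \<forall>h\<in>carrier (H1 T). nrm (H1 T) h < \<delta> \<longrightarrow>
        nrm (H1 T) (nemytskii T f (\<gamma> + h) - nemytskii T f \<gamma>
          - mult_op T (\<lambda>i. nemytskii T (partial_derivative i f) \<gamma>) h) \<le> \<epsilon> * nrm (H1 T) h"
      by (intro exI[of _ d]) (simp add: mult_op_partial_derivatives[OF f])
  qed
qed

text \<open>The map is the composition of scalar superpositions with \<open>mult_op\<close>, which
  is linear and bounded in its multipliers. Differentiability of the superpositions is therefore
  inherited in operator norm.\<close>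

lemma mult_op_nemytskii_has_frechet_derivative:
  fixes f :: "'n::finite \<Rightarrow> real ^ 'n \<Rightarrow> real"
  assumes f: "\<And>j. C_k (Suc (Suc k)) (f j)" and g: "\<gamma> \<in> carrier (H1 T)" and T: "T > 0"
  shows "has_frechet_derivative (H1 T) (operator_space (H1 T) (H1 T)) (\<lambda>\<gamma>. mult_op T (\<lambda>j. nemytskii T (f j) \<gamma>))
    (mult_op2 T (\<lambda>i j. nemytskii T (partial_derivative i (f j)) \<gamma>)) \<gamma>"
  unfolding has_frechet_derivative_def
proof (intro conjI allI impI)
  have N: "nemytskii T (f j) \<gamma> \<in> carrier (H1 T)" if "\<gamma> \<in> carrier (H1 T)" for j \<gamma>
    by (rule nemytskii_in_H1[OF C_k_Suc_imp_C1_deriv[OF f] that T])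
  have pd: "nemytskii T (partial_derivative i (f j)) \<gamma> \<in> carrier (H1 T)" for i j
    by (rule nemytskii_in_H1[OF C_k_Suc_imp_C1_deriv[OF C_k_partial_derivative[OF f]] g T])
  then show "mult_op2 T (\<lambda>i j. nemytskii T (partial_derivative i (f j)) \<gamma>)
      \<in> carrier (operator_space (H1 T) (operator_space (H1 T) (H1 T)))"
    by (rule mult_op2_in_operator_space[OF _ T])
  fix \<epsilon> :: real assume "\<epsilon> > 0"
  obtain C where C: "C > 0" "\<And>m :: 'n \<Rightarrow> real \<Rightarrow> real. (\<And>j. m j \<in> carrier (H1 T)) \<Longrightarrow>
      nrm (operator_space (H1 T) (H1 T)) (mult_op T m) \<le> C * (\<Sum>j\<in>UNIV. nrm (H1 T) (m j))"
    using mult_op_norm_bound[OF T, where 'n = 'n] by blast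
  define n where "n = real CARD('n)"
  have n: "n > 0" by (simp add: n_def)
  \<comment> \<open>There are \<open>n\<close> remainders, and passing to the operator norm costs
    the factor \<open>C\<close>.\<close>
  define e where "e = \<epsilon> / (C * n)"
  have e: "e > 0" using \<open>\<epsilon> > 0\<close> C(1) n by (simp add: e_def)
  define R where "R j h = nemytskii T (f j) (\<gamma> + h) - nemytskii T (f j) \<gamma>
      - mult_op T (\<lambda>i. nemytskii T (partial_derivative i (f j)) \<gamma>) h" for j h
  have "\<exists>d>0. \<forall>h. nrm (H1 T) h < d \<longrightarrow> h \<in> carrier (H1 T) \<longrightarrow> nrm (H1 T) (R j h) \<le> e * nrm (H1 T) h" for j
    using nemytskii_has_frechet_derivative[OF f g T, of j] e
    unfolding has_frechet_derivative_def R_def by blast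
  from finite_family_pos_bound[where N = "nrm (H1 T)" and I = UNIV
      and P = "\<lambda>j h. h \<in> carrier (H1 T) \<longrightarrow> nrm (H1 T) (R j h) \<le> e * nrm (H1 T) h", OF finite this]
  obtain d where d: "d > 0"
    and R: "\<forall>h. nrm (H1 T) h < d \<longrightarrow> (\<forall>j\<in>UNIV. h \<in> carrier (H1 T) \<longrightarrow> nrm (H1 T) (R j h) \<le> e * nrm (H1 T) h)"
    by (elim exE conjE)
  show "\<exists>\<delta>>0. \<forall>h\<in>carrier (H1 T). nrm (H1 T) h < \<delta> \<longrightarrow>
      nrm (operator_space (H1 T) (H1 T)) (mult_op T (\<lambda>j. nemytskii T (f j) (\<gamma> + h)) - mult_op T (\<lambda>j. nemytskii T (f j) \<gamma>)
        - mult_op2 T (\<lambda>i j. nemytskii T (partial_derivative i (f j)) \<gamma>) h) \<le> \<epsilon> * nrm (H1 T) h"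
  proof (intro exI[of _ d] conjI ballI impI d)
    fix h :: "real \<Rightarrow> real ^ 'n" assume h: "h \<in> carrier (H1 T)" "nrm (H1 T) h < d"
    \<comment> \<open>All three terms are multiplication operators, hence so is the remainder, with
      the scalar remainders \<open>R j h\<close> as multipliers.\<close>
    have eq: "mult_op T (\<lambda>j. nemytskii T (f j) (\<gamma> + h)) - mult_op T (\<lambda>j. nemytskii T (f j) \<gamma>)
        - mult_op2 T (\<lambda>i j. nemytskii T (partial_derivative i (f j)) \<gamma>) h = mult_op T (\<lambda>j. R j h)"
      using h(1) by (simp add: R_def mult_op_diff mult_op2_def zero_ext_def)
    have "nrm (operator_space (H1 T) (H1 T)) (mult_op T (\<lambda>j. R j h)) \<le> C * (\<Sum>j\<in>UNIV. nrm (H1 T) (R j h))"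
    proof (rule C(2))
      have "mult_op T (\<lambda>i. nemytskii T (partial_derivative i (f j)) \<gamma>) h \<in> carrier (H1 T)" for j
        using mult_op_in_operator_space[OF pd T, of "\<lambda>i. i" "\<lambda>i. j"] h(1)
        unfolding operator_space_def bounded_operator_def by auto
      then show "R j h \<in> carrier (H1 T)" for j
        unfolding R_def by (intro carrier_H1_diff N carrier_H1_add g h T)
    qed
    also have "\<dots> \<le> C * (\<Sum>j\<in>(UNIV :: 'n set). e * nrm (H1 T) h)"
      using C(1) R h by (intro mult_left_mono sum_mono) auto
    also have "\<dots> = \<epsilon> * nrm (H1 T) h"
      using C(1) n by (simp add: e_def n_def)
    finally show "nrm (operator_space (H1 T) (H1 T)) (mult_op T (\<lambda>j. nemytskii T (f j) (\<gamma> + h)) - mult_op T (\<lambda>j. nemytskii T (f j) \<gamma>)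
        - mult_op2 T (\<lambda>i j. nemytskii T (partial_derivative i (f j)) \<gamma>) h) \<le> \<epsilon> * nrm (H1 T) h"
      by (simp only: eq)
  qed
qed

lemma nemytskii_family_continuous:
  fixes f :: "'i \<Rightarrow> 'a::euclidean_space \<Rightarrow> real"
  assumes f: "\<And>i. i \<in> I \<Longrightarrow> C_k (Suc k) (f i)" and "finite I"
    and x: "x \<in> carrier (H1 T)" and T: "T > 0" and e: "e > 0"
  shows "\<exists>d>0. \<forall>y\<in>carrier (H1 T). nrm (H1 T) (y - x) < d \<longrightarrow>
    (\<Sum>i\<in>I. nrm (H1 T) (nemytskii T (f i) y - nemytskii T (f i) x)) < e"
proof -
  \<comment> \<open>The \<open>+ 1\<close> makes the final bound strict although each summand is
    only at most \<open>c\<close>, and it covers an empty \<open>I\<close>.\<close>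
  define c where "c = e / (real (card I) + 1)"
  have c: "c > 0" using e by (simp add: c_def add_nonneg_pos)
  have "\<exists>d>0. \<forall>h. nrm (H1 T) h < d \<longrightarrow> h \<in> carrier (H1 T) \<longrightarrow>
      nrm (H1 T) (nemytskii T (f i) (x + h) - nemytskii T (f i) x) \<le> c" if "i \<in> I" for i
    by (rule nemytskii_continuous[OF C_k_Suc_imp_C1_deriv[OF f[OF that]] x T c])
  with \<open>finite I\<close> have "\<exists>d>0. \<forall>h. nrm (H1 T) h < d \<longrightarrow> (\<forall>i\<in>I. h \<in> carrier (H1 T) \<longrightarrow>
      nrm (H1 T) (nemytskii T (f i) (x + h) - nemytskii T (f i) x) \<le> c)"
    by (rule finite_family_pos_bound)
  then obtain d where d: "d > 0" and le: "\<forall>h. nrm (H1 T) h < d \<longrightarrow> (\<forall>i\<in>I. h \<in> carrier (H1 T) \<longrightarrow>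
      nrm (H1 T) (nemytskii T (f i) (x + h) - nemytskii T (f i) x) \<le> c)"
    by (elim exE conjE)
  show ?thesis
  proof (intro exI[of _ d] conjI ballI impI d)
    fix y assume y: "y \<in> carrier (H1 T)" "nrm (H1 T) (y - x) < d"
    have "x + (y - x) = y" by simp
    then have "nrm (H1 T) (nemytskii T (f i) y - nemytskii T (f i) x) \<le> c" if "i \<in> I" for i
      using le[rule_format, OF y(2) that carrier_H1_diff[OF y(1) x T]] by (simp only:)
    then have "(\<Sum>i\<in>I. nrm (H1 T) (nemytskii T (f i) y - nemytskii T (f i) x)) \<le> (\<Sum>i\<in>I. c)"
      by (rule sum_mono)
    also have "\<dots> = real (card I) * c" by simp
    also have "\<dots> < (real (card I) + 1) * c" using c by simp
    also have "\<dots> = e"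
      by (simp add: c_def add_nonneg_eq_0_iff)
    finally show "(\<Sum>i\<in>I. nrm (H1 T) (nemytskii T (f i) y - nemytskii T (f i) x)) < e" .
  qed
qed

lemma mult_op_nemytskii_continuous:
  fixes f :: "'n::finite \<Rightarrow> real ^ 'n \<Rightarrow> real"
  assumes f: "\<And>j. C_k (Suc k) (f j)" and T: "T > 0"
  shows "continuous_map_nspace (H1 T) (operator_space (H1 T) (H1 T)) (\<lambda>\<gamma>. mult_op T (\<lambda>j. nemytskii T (f j) \<gamma>))"
proof -
  have N: "nemytskii T (f j) \<gamma> \<in> carrier (H1 T)" if "\<gamma> \<in> carrier (H1 T)" for j \<gamma>
    by (rule nemytskii_in_H1[OF C_k_Suc_imp_C1_deriv[OF f] that T])
  obtain C where C: "C > 0" "\<And>m :: 'n \<Rightarrow> real \<Rightarrow> real. (\<And>j. m j \<in> carrier (H1 T)) \<Longrightarrow>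
      nrm (operator_space (H1 T) (H1 T)) (mult_op T m) \<le> C * (\<Sum>j\<in>UNIV. nrm (H1 T) (m j))"
    using mult_op_norm_bound[OF T, where 'n = 'n] by blast
  show ?thesis
    unfolding continuous_map_nspace_def
  proof (intro conjI ballI allI impI)
    show "(\<lambda>\<gamma>. mult_op T (\<lambda>j. nemytskii T (f j) \<gamma>)) ` carrier (H1 T) \<subseteq> carrier (operator_space (H1 T) (H1 T))"
      using N by (auto intro: mult_op_in_operator_space[OF _ T])
    fix x :: "real \<Rightarrow> real ^ 'n" and \<epsilon> :: real assume x: "x \<in> carrier (H1 T)" and \<epsilon>: "\<epsilon> > 0"
    obtain d where d: "d > 0" "\<And>y. y \<in> carrier (H1 T) \<Longrightarrow> nrm (H1 T) (y - x) < d \<Longrightarrow>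
        (\<Sum>j\<in>UNIV. nrm (H1 T) (nemytskii T (f j) y - nemytskii T (f j) x)) < \<epsilon> / C"
      using nemytskii_family_continuous[of UNIV k f x T "\<epsilon> / C", OF f finite x T divide_pos_pos[OF \<epsilon> C(1)]]
      by blast
    show "\<exists>\<delta>>0. \<forall>y\<in>carrier (H1 T). nrm (H1 T) (y - x) < \<delta> \<longrightarrow>
        nrm (operator_space (H1 T) (H1 T)) (mult_op T (\<lambda>j. nemytskii T (f j) y) - mult_op T (\<lambda>j. nemytskii T (f j) x)) < \<epsilon>"
    proof (intro exI[of _ d] conjI ballI impI d(1))
      fix y :: "real \<Rightarrow> real ^ 'n" assume y: "y \<in> carrier (H1 T)" "nrm (H1 T) (y - x) < d"
      have "nrm (operator_space (H1 T) (H1 T)) (mult_op T (\<lambda>j. nemytskii T (f j) y - nemytskii T (f j) x))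
          \<le> C * (\<Sum>j\<in>UNIV. nrm (H1 T) (nemytskii T (f j) y - nemytskii T (f j) x))"
        by (intro C(2) carrier_H1_diff N x y T)
      also have "\<dots> < \<epsilon>"
        using d(2)[OF y] C(1) by (simp add: field_simps)
      finally show "nrm (operator_space (H1 T) (H1 T)) (mult_op T (\<lambda>j. nemytskii T (f j) y) - mult_op T (\<lambda>j. nemytskii T (f j) x)) < \<epsilon>"
        by (simp only: mult_op_diff)
    qed
  qed
qed

lemma mult_op2_nemytskii_continuous:
  fixes f :: "'n::finite \<Rightarrow> 'n \<Rightarrow> real ^ 'n \<Rightarrow> real"
  assumes f: "\<And>i j. C_k (Suc k) (f i j)" and T: "T > 0"
  shows "continuous_map_nspace (H1 T) (operator_space (H1 T) (operator_space (H1 T) (H1 T)))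
    (\<lambda>\<gamma>. mult_op2 T (\<lambda>i j. nemytskii T (f i j) \<gamma>))"
proof -
  have N: "nemytskii T (f i j) \<gamma> \<in> carrier (H1 T)" if "\<gamma> \<in> carrier (H1 T)" for i j \<gamma>
    by (rule nemytskii_in_H1[OF C_k_Suc_imp_C1_deriv[OF f] that T])
  obtain C where C: "C > 0" "\<And>(m :: 'n \<Rightarrow> 'n \<Rightarrow> real \<Rightarrow> real) \<delta>. (\<And>i j. m i j \<in> carrier (H1 T)) \<Longrightarrow> \<delta> \<in> carrier (H1 T) \<Longrightarrow>
      nrm (operator_space (H1 T) (H1 T)) (mult_op2 T m \<delta>)
        \<le> C * (\<Sum>j\<in>UNIV. \<Sum>i\<in>UNIV. nrm (H1 T) (m i j)) * nrm (H1 T) \<delta>"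
    using mult_op2_bound[OF T, where 'n = 'n] by blast
  show ?thesis
    unfolding continuous_map_nspace_def
  proof (intro conjI ballI allI impI)
    show "(\<lambda>\<gamma>. mult_op2 T (\<lambda>i j. nemytskii T (f i j) \<gamma>)) ` carrier (H1 T)
        \<subseteq> carrier (operator_space (H1 T) (operator_space (H1 T) (H1 T)))"
      using N by (auto intro: mult_op2_in_operator_space[OF _ T])
    fix x :: "real \<Rightarrow> real ^ 'n" and \<epsilon> :: real assume x: "x \<in> carrier (H1 T)" and \<epsilon>: "\<epsilon> > 0"
    \<comment> \<open>The index pairs are \<open>(j, i)\<close>, in the order of the double sum
      \<open>M\<close> below, whose outer index is \<open>j\<close>.\<close>
    obtain d where d: "d > 0" "\<And>y. y \<in> carrier (H1 T) \<Longrightarrow> nrm (H1 T) (y - x) < d \<Longrightarrow>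
        (\<Sum>p\<in>UNIV. nrm (H1 T) (nemytskii T (f (snd p) (fst p)) y - nemytskii T (f (snd p) (fst p)) x)) < \<epsilon> / C"
      using nemytskii_family_continuous[of UNIV k "\<lambda>p. f (snd p) (fst p)" x T "\<epsilon> / C",
          OF f finite x T divide_pos_pos[OF \<epsilon> C(1)]]
      by blast
    show "\<exists>\<delta>>0. \<forall>y\<in>carrier (H1 T). nrm (H1 T) (y - x) < \<delta> \<longrightarrow>
        nrm (operator_space (H1 T) (operator_space (H1 T) (H1 T)))
          (mult_op2 T (\<lambda>i j. nemytskii T (f i j) y) - mult_op2 T (\<lambda>i j. nemytskii T (f i j) x)) < \<epsilon>"
    proof (intro exI[of _ d] conjI ballI impI d(1))
      fix y :: "real \<Rightarrow> real ^ 'n" assume y: "y \<in> carrier (H1 T)" "nrm (H1 T) (y - x) < d"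
      define M where "M = (\<Sum>j\<in>UNIV. \<Sum>i\<in>UNIV. nrm (H1 T) (nemytskii T (f i j) y - nemytskii T (f i j) x))"
      have "M < \<epsilon> / C"
        using d(2)[OF y] by (simp add: M_def sum.cartesian_product case_prod_beta)
      have "nrm (operator_space (H1 T) (operator_space (H1 T) (H1 T)))
          (mult_op2 T (\<lambda>i j. nemytskii T (f i j) y - nemytskii T (f i j) x)) \<le> C * M"
      proof (rule nrm_operator_space_H1_le[OF T])
        show "0 \<le> C * M"
          unfolding M_def using C(1) by (intro mult_nonneg_nonneg sum_nonneg nrm_H1_nonneg) auto
        show "nrm (operator_space (H1 T) (H1 T)) (mult_op2 T (\<lambda>i j. nemytskii T (f i j) y - nemytskii T (f i j) x) \<delta>)
            \<le> C * M * nrm (H1 T) \<delta>" if "\<delta> \<in> carrier (H1 T)" for \<delta>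
          unfolding M_def by (intro C(2) carrier_H1_diff N x y T that)
      qed
      also have "\<dots> < \<epsilon>"
        using \<open>M < \<epsilon> / C\<close> C(1) by (simp add: field_simps)
      finally show "nrm (operator_space (H1 T) (operator_space (H1 T) (H1 T)))
          (mult_op2 T (\<lambda>i j. nemytskii T (f i j) y) - mult_op2 T (\<lambda>i j. nemytskii T (f i j) x)) < \<epsilon>"
        by (simp only: mult_op2_diff)
    qed
  qed
qed

theorem proposition5p1:
  fixes T :: real and g :: "real ^ 2 \<Rightarrow> real"
  assumes "T > 0"
    and "C_k 3 g"
    and "{x. g x \<le> 0} \<noteq> {}"
    and "compact {x. g x \<le> 0}"
    and "\<And>x. g x = 0 \<Longrightarrow> frechet_derivative g (at x) \<noteq> (\<lambda>v. 0)"
  shows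
    "let X = (H1 T :: (real \<Rightarrow> real ^ 2) nspace);
         Y = (H1 T :: (real \<Rightarrow> real) nspace);
         G = (\<lambda>\<gamma>. zero_ext {0..T} (g \<circ> \<gamma>));
         DG = (\<lambda>\<gamma>. zero_ext (carrier X) (\<lambda>\<delta>.
                zero_ext {0..T} (\<lambda>t. frechet_derivative g (at (\<gamma> t)) (\<delta> t))));
         D2G = (\<lambda>\<gamma>. zero_ext (carrier X) (\<lambda>\<delta>. zero_ext (carrier X) (\<lambda>\<delta>'.
                zero_ext {0..T} (\<lambda>t. \<delta> t \<bullet> (hessian g (\<gamma> t) *v \<delta>' t)))))
     in twice_continuously_frechet_differentiable X Y G \<and>
        (\<forall>\<gamma>\<in>carrier X. has_frechet_derivative X Y G (DG \<gamma>) \<gamma>) \<and>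
        (\<forall>\<gamma>\<in>carrier X. has_frechet_derivative X (operator_space X Y) DG (D2G \<gamma>) \<gamma>)"
proof -
  define DG where "DG \<gamma> = mult_op T (\<lambda>j. nemytskii T (partial_derivative j g) \<gamma>)" for \<gamma>
  define D2G where "D2G \<gamma> = mult_op2 T (\<lambda>i j. nemytskii T (partial_derivative i (partial_derivative j g)) \<gamma>)" for \<gamma>
  have C3: "C_k (Suc (Suc (Suc 0))) g"
    using assms(2) by (simp only: numeral_3_eq_3)
  \<comment> \<open>Two derivatives remain for the first partial derivatives, enough to
    differentiate \<open>DG\<close>; one remains for the second partial derivatives, enough for
    continuity of \<open>D2G\<close>.\<close>
  have C2: "C_k (Suc (Suc 0)) (partial_derivative j g)" for j
    by (rule C_k_partial_derivative[OF C3])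
  have C1: "C_k (Suc 0) (partial_derivative i (partial_derivative j g))" for i j
    by (rule C_k_partial_derivative[OF C2])
  have DG_eq: "zero_ext (carrier (H1 T)) (\<lambda>\<delta>.
      zero_ext {0..T} (\<lambda>t. frechet_derivative g (at (\<gamma> t)) (\<delta> t))) = DG \<gamma>" for \<gamma>
  proof (intro ext)
    fix \<delta> t
    show "zero_ext (carrier (H1 T)) (\<lambda>\<delta>.
        zero_ext {0..T} (\<lambda>t. frechet_derivative g (at (\<gamma> t)) (\<delta> t))) \<delta> t = DG \<gamma> \<delta> t"
      using mult_op_partial_derivatives[OF C3, of \<delta> T \<gamma>]
      by (cases "\<delta> \<in> carrier (H1 T)") (auto simp: DG_def zero_ext_def mult_op_def)
  qed
  \<comment> \<open>Row \<open>i\<close> and column \<open>j\<close> of \<open>hessian\<close> hold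
    the partial derivative \<open>i\<close> of the partial derivative \<open>j\<close>, the index
    order of \<open>mult_op2\<close>: the row index is contracted with \<open>\<delta>\<close> and
    the column index with \<open>\<delta>'\<close>.\<close>
  have D2G_eq: "zero_ext (carrier (H1 T)) (\<lambda>\<delta>. zero_ext (carrier (H1 T)) (\<lambda>\<delta>'.
      zero_ext {0..T} (\<lambda>t. \<delta> t \<bullet> (hessian g (\<gamma> t) *v \<delta>' t)))) = D2G \<gamma>" for \<gamma>
    by (auto simp: fun_eq_iff D2G_def mult_op2_def mult_op_def zero_ext_def nemytskii_def UNIV_2
        inner_vec_def matrix_vector_mult_def hessian_def algebra_simps)
  have DG: "has_frechet_derivative (H1 T) (H1 T) (nemytskii T g) (DG \<gamma>) \<gamma>" if "\<gamma> \<in> carrier (H1 T)" for \<gamma>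
    unfolding DG_def by (rule nemytskii_has_frechet_derivative[OF C3 that \<open>T > 0\<close>])
  have D2G: "has_frechet_derivative (H1 T) (operator_space (H1 T) (H1 T)) DG (D2G \<gamma>) \<gamma>"
    if "\<gamma> \<in> carrier (H1 T)" for \<gamma>
    unfolding DG_def[abs_def] D2G_def
    by (rule mult_op_nemytskii_has_frechet_derivative[OF C2 that \<open>T > 0\<close>])
  have "nemytskii T g ` carrier (H1 T) \<subseteq> carrier (H1 T)"
    using nemytskii_in_H1[OF C_k_Suc_imp_C1_deriv[OF C3] _ \<open>T > 0\<close>] by blast
  moreover have "continuous_map_nspace (H1 T) (operator_space (H1 T) (H1 T)) DG"
    unfolding DG_def[abs_def] by (rule mult_op_nemytskii_continuous[OF C2 \<open>T > 0\<close>])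
  moreover have "continuous_map_nspace (H1 T) (operator_space (H1 T) (operator_space (H1 T) (H1 T))) D2G"
    unfolding D2G_def[abs_def] by (rule mult_op2_nemytskii_continuous[OF C1 \<open>T > 0\<close>])
  ultimately have "twice_continuously_frechet_differentiable (H1 T) (H1 T) (nemytskii T g)"
    unfolding twice_continuously_frechet_differentiable_def using DG D2G by blast
  with DG D2G show ?thesis
    unfolding Let_def DG_eq D2G_eq nemytskii_def[symmetric] by blast
qed

end
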